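(* Let $d\ge 1$, $D=d+1$, and let $\{\alpha(\mathbf k)\}_{\mathbf k\in\mathbb R^d}$ be a family of matching matrices. Then the following are equivalent: (1) $\alpha$ is equivariantly null-homotopic; (2) $\alpha$ admits a multi-step logarithm; (3) there exists a map $\beta:\mathbb R^D\to U(m)$, $(k_1,\mathbf k)\mapsto\beta(k_1,\mathbf k)$, such that (a) $\beta$ is continuous; (b) for each fixed $k_1\in\mathbb R$, $\mathbf k\mapsto\beta(k_1,\mathbf k)$ is $\mathbb Z^d$-periodic; (c) $\beta(-k_1,-\mathbf k)=\varepsilon^{-1}\,\overline{\beta(k_1,\mathbf k)}\,\varepsilon$ for all $(k_1,\mathbf k)\in\mathbb R^D$ (bar denotes entrywise complex conjugation); (d) $\alpha(\mathbf k)=\beta(k_1,\mathbf k)\,\beta(k_1+1,\mathbf k)^{-1}$ for all $(k_1,\mathbf k)\in\mathbb R^D$.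
   Context: Fix $m\ge1$. Let $\varepsilon$ denote either the $m\times m$ identity matrix $\mathbf 1$ (bosonic case) or, when $m$ is even, the standard symplectic matrix $J=\begin{pmatrix}0&\mathbf 1\\-\mathbf 1&0\end{pmatrix}$ (fermionic case). A family of matching matrices is a map $\alpha:\mathbb R^d\to U(m)$ which is continuous, $\mathbb Z^d$-periodic ($\alpha(\mathbf k+\mathbf n)=\alpha(\mathbf k)$ for $\mathbf n\in\mathbb Z^d$) and time-reversal symmetric: $\varepsilon\,\alpha(\mathbf k)=\alpha(-\mathbf k)^t\,\varepsilon$ for all $\mathbf k$ ($t$ = transpose). Two families of matching matrices $\alpha_0,\alpha_1$ are equivariantly homotopic if there is a map $(t,\mathbf k)\mapsto\alpha_t(\mathbf k)$, continuous in $t\in[0,1]$, such that for each fixed $t$ the map $\alpha_t$ is a family of matching matrices, and $\alpha_{t=0}=\alpha_0$, $\alpha_{t=1}=\alpha_1$. A family is equivariantly null-homotopic if it is equivariantly homotopic to the constant family $\mathbf k\mapsto\mathbf 1$. A family of matching matrices $\alpha$ admits a multi-step logarithm if there are $M\in\mathbb N$ and maps $h_1,\dots,h_M:\mathbb R^d\to M_m(\mathbb C)$ such that each $h_\ell(\mathbf k)$ is self-adjoint, each $h_\ell$ is continuous, $\mathbb Z^d$-periodic, and satisfies $\varepsilon\,h_\ell(\mathbf k)=h_\ell(-\mathbf k)^t\,\varepsilon$, and for all $\mathbf k$: $\alpha(\mathbf k)=e^{ih_M(\mathbf k)/2}\cdots e^{ih_2(\mathbf k)/2}\,e^{ih_1(\mathbf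 k)}\,e^{ih_2(\mathbf k)/2}\cdots e^{ih_M(\mathbf k)/2}$. *)

theory Defs
  imports "HOL-Analysis.Analysis" "Jordan_Normal_Form.Gauss_Jordan_Elimination"
begin

text \<open>Complex m x m matrices are Jordan_Normal_Form matrices (type complex mat) with explicit
  dimension m.  Momentum space R^d is an arbitrary Euclidean space 'd (dimension d = DIM('d) \<ge> 1),
  and R^D = R x R^d is the product space real \<times> 'd.\<close>

definition adj_mat :: "complex mat \<Rightarrow> complex mat" where
  "adj_mat A = transpose_mat (map_mat cnj A)"

definition unitary_m :: "nat \<Rightarrow> complex mat \<Rightarrow> bool" where
  "unitary_m m U \<longleftrightarrow> U \<in> carrier_mat m m \<and> U * adj_mat U = 1\<^sub>m m \<and> adj_mat U * U = 1\<^sub>m m"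

definition selfadj_m :: "nat \<Rightarrow> complex mat \<Rightarrow> bool" where
  "selfadj_m m H \<longleftrightarrow> H \<in> carrier_mat m m \<and> adj_mat H = H"

definition mexp :: "complex mat \<Rightarrow> complex mat" where
  "mexp A = Matrix.mat (dim_row A) (dim_col A)
      (\<lambda>(i,j). \<Sum>n. (A ^\<^sub>m n) $$ (i,j) / of_real (fact n))"

definition Jsymp :: "nat \<Rightarrow> complex mat" where
  "Jsymp m = Matrix.mat m m (\<lambda>(i,j).
      if i < m div 2 \<and> j = i + m div 2 then 1
      else if m div 2 \<le> i \<and> j + m div 2 = i then -1 else 0)"

text \<open>Admissible epsilon: identity (bosonic) or, for even m, J (fermionic).\<close>
definition eps_ok :: "nat \<Rightarrow> complex mat \<Rightarrow> bool" where
  "eps_ok m \<epsilon> \<longleftrightarrow> \<epsilon> = 1\<^sub>m m \<or> (even m \<and> \<epsilon> = Jsymp m)"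

text \<open>Continuity of a matrix-valued map (entrywise, equivalently in any matrix norm).\<close>
definition cont_mat :: "nat \<Rightarrow> 'a::topological_space set \<Rightarrow> ('a \<Rightarrow> complex mat) \<Rightarrow> bool" where
  "cont_mat m S f \<longleftrightarrow> (\<forall>i<m. \<forall>j<m. continuous_on S (\<lambda>x. f x $$ (i,j)))"

definition Zperiodic :: "('d::euclidean_space \<Rightarrow> 'b) \<Rightarrow> bool" where
  "Zperiodic f \<longleftrightarrow> (\<forall>k n. (\<forall>b\<in>Basis. n \<bullet> b \<in> \<int>) \<longrightarrow> f (k + n) = f k)"

definition matching_family :: "nat \<Rightarrow> complex mat \<Rightarrow> ('d::euclidean_space \<Rightarrow> complex mat) \<Rightarrow> bool" where
  "matching_family m \<epsilon> \<alpha> \<longleftrightarrow>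
     (\<forall>k. unitary_m m (\<alpha> k)) \<and> cont_mat m UNIV \<alpha> \<and> Zperiodic \<alpha> \<and>
     (\<forall>k. \<epsilon> * \<alpha> k = transpose_mat (\<alpha> (- k)) * \<epsilon>)"

definition equiv_homotopic ::
  "nat \<Rightarrow> complex mat \<Rightarrow> ('d::euclidean_space \<Rightarrow> complex mat) \<Rightarrow> ('d \<Rightarrow> complex mat) \<Rightarrow> bool" where
  "equiv_homotopic m \<epsilon> \<alpha>0 \<alpha>1 \<longleftrightarrow>
     (\<exists>H :: real \<Rightarrow> 'd \<Rightarrow> complex mat.
        cont_mat m ({0..1} \<times> UNIV) (\<lambda>(t,k). H t k) \<and>
        (\<forall>t\<in>{0..1}. matching_family m \<epsilon> (H t)) \<and>
        H 0 = \<alpha>0 \<and> H 1 = \<alpha>1)"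

definition equiv_null_homotopic :: "nat \<Rightarrow> complex mat \<Rightarrow> ('d::euclidean_space \<Rightarrow> complex mat) \<Rightarrow> bool" where
  "equiv_null_homotopic m \<epsilon> \<alpha> \<longleftrightarrow> equiv_homotopic m \<epsilon> \<alpha> (\<lambda>k. 1\<^sub>m m)"

fun msl_prod :: "(nat \<Rightarrow> complex mat) \<Rightarrow> nat \<Rightarrow> complex mat" where
  "msl_prod h 0 = undefined"
| "msl_prod h (Suc 0) = mexp (\<i> \<cdot>\<^sub>m h 1)"
| "msl_prod h (Suc (Suc l)) =
     mexp ((\<i> / 2) \<cdot>\<^sub>m h (Suc (Suc l))) * msl_prod h (Suc l) * mexp ((\<i> / 2) \<cdot>\<^sub>m h (Suc (Suc l)))"

definition multistep_log :: "nat \<Rightarrow> complex mat \<Rightarrow> ('d::euclidean_space \<Rightarrow> complex mat) \<Rightarrow> bool" where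
  "multistep_log m \<epsilon> \<alpha> \<longleftrightarrow>
     (\<exists>M::nat. M \<ge> 1 \<and> (\<exists>h :: nat \<Rightarrow> 'd \<Rightarrow> complex mat.
        (\<forall>l\<in>{1..M}. (\<forall>k. selfadj_m m (h l k)) \<and> cont_mat m UNIV (h l) \<and> Zperiodic (h l) \<and>
                     (\<forall>k. \<epsilon> * h l k = transpose_mat (h l (- k)) * \<epsilon>)) \<and>
        (\<forall>k. \<alpha> k = msl_prod (\<lambda>l. h l k) M)))"

definition beta_cond ::
  "nat \<Rightarrow> complex mat \<Rightarrow> ('d::euclidean_space \<Rightarrow> complex mat) \<Rightarrow> (real \<times> 'd \<Rightarrow> complex mat) \<Rightarrow> bool" where
  "beta_cond m \<epsilon> \<alpha> \<beta> \<longleftrightarrow>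
     (\<forall>x. unitary_m m (\<beta> x)) \<and>
     cont_mat m UNIV \<beta> \<and>
     (\<forall>k1. Zperiodic (\<lambda>k. \<beta> (k1, k))) \<and>
     (\<forall>k1 k. \<beta> (- k1, - k) = the (mat_inverse \<epsilon>) * map_mat cnj (\<beta> (k1, k)) * \<epsilon>) \<and>
     (\<forall>k1 k. \<alpha> k = \<beta> (k1, k) * the (mat_inverse (\<beta> (k1 + 1, k))))"

end

(* The condition eps X = Y^t eps says X = flip Y, where flip Y = eps^t Y^t eps is an
   anti-automorphism of order two that commutes with exp and with the adjoint.

   (1) => (2): subdivide the homotopy so finely that consecutive families alpha_j, alpha_(j+1),
   starting at alpha_0 = 1, are uniformly close.  Then alpha_1 = exp(i h) for the unique small
   logarithm, which inherits continuity, periodicity and symmetry by uniqueness.  Replacing each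
   alpha_j by exp(-i h/2) alpha_j exp(-i h/2) preserves all hypotheses and gives a chain from 1
   with one step fewer; closeness is measured so that it is invariant under unitary factors.

   (2) => (3): for |t| <= 1/2 put b(t) = exp(-i t h_M) ... exp(-i t h_1), so that
   alpha = b(-1/2) b(1/2)^(-1), and extend by beta(n + t) = alpha^(-n) b(t).

   (3) => (1): beta(-t/2) beta(t/2)^(-1) joins 1 (at t = 0) to alpha (at t = 1). *)

theory Submission imports Defs begin

text \<open>Two algebraic facts dictate the shapes. \<open>flip\<close> reverses products, so a
  product of symmetric families is in general symmetric only if it is a palindrome; this is why each
  logarithm is split into two halves, one on either side. The map X ->
  \<open>flip (adj_mat X)\<close> preserves the order of products, and condition (c) is equivariance
  under it. Hence (c) can be verified factor by factor for the one-sided product b(t). It exchanges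
  t and -t, which is why the basic interval is symmetric about 0 and the pieces are glued at
  half-integers. On the analytic side, existence, uniqueness and continuity of the small logarithm
  all come from one estimate: on the ball of radius 1/4, exp minus the identity map is a contraction
  with factor 1/2. The norm is an entrywise one, submultiplicative but not invariant under unitary
  factors, so \<open>flip\<close> may enlarge it by m^4. Uniqueness holds only inside the ball, and
  the closeness of consecutive families has to make up for that factor.\<close>

section \<open>An entrywise submultiplicative norm\<close>

definition mnorm :: "complex mat \<Rightarrow> real" where
  "mnorm A = (\<Sum>i<dim_row A. \<Sum>j<dim_col A. cmod (A $$ (i,j)))"

lemma mult_carrier_square [simp]:
  "A \<in> carrier_mat m m \<Longrightarrow> B \<in> carrier_mat m m \<Longrightarrow> A * B \<in> carrier_mat m m"
  by (rule mult_carrier_mat)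

declare minus_carrier_mat [simp]

lemma mnorm_carrier:
  "A \<in> carrier_mat m m \<Longrightarrow> mnorm A = (\<Sum>i<m. \<Sum>j<m. cmod (A $$ (i,j)))"
  by (auto simp: mnorm_def)

lemma mnorm_nonneg: "0 \<le> mnorm A"
  by (auto simp: mnorm_def intro!: sum_nonneg)

lemma entry_le_mnorm:
  assumes "A \<in> carrier_mat m m" "i < m" "j < m"
  shows "cmod (A $$ (i,j)) \<le> mnorm A"
proof -
  have "cmod (A $$ (i,j)) \<le> (\<Sum>j<m. cmod (A $$ (i,j)))"
    using assms by (intro member_le_sum) auto
  also have "\<dots> \<le> (\<Sum>i<m. \<Sum>j<m. cmod (A $$ (i,j)))"
    using assms by (intro member_le_sum[where f = "\<lambda>i. \<Sum>j<m. cmod (A $$ (i,j))"] sum_nonneg) auto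
  finally show ?thesis using assms by (simp add: mnorm_carrier)
qed

lemma mnorm_le_entries:
  assumes "A \<in> carrier_mat m m" "\<And>i j. i < m \<Longrightarrow> j < m \<Longrightarrow> cmod (A $$ (i,j)) \<le> c"
  shows "mnorm A \<le> real m * real m * c"
proof -
  have "mnorm A \<le> (\<Sum>i<m. \<Sum>j<m. c)"
    unfolding mnorm_carrier[OF assms(1)] using assms(2) by (intro sum_mono) auto
  then show ?thesis by simp
qed

lemma mnorm_triangle:
  assumes "A \<in> carrier_mat m m" "B \<in> carrier_mat m m"
  shows "mnorm (A + B) \<le> mnorm A + mnorm B"
proof -
  have "mnorm (A + B) \<le> (\<Sum>i<m. \<Sum>j<m. cmod (A $$ (i,j)) + cmod (B $$ (i,j)))"
    using assms by (subst mnorm_carrier[of _ m])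
      (auto intro!: sum_mono norm_triangle_ineq)
  then show ?thesis using assms by (simp add: mnorm_carrier sum.distrib)
qed

lemma mnorm_uminus: "mnorm (- A) = mnorm A"
  by (simp add: mnorm_def)

lemma mnorm_smult: "mnorm (c \<cdot>\<^sub>m A) = cmod c * mnorm A"
  by (simp add: mnorm_def norm_mult sum_distrib_left)

lemma mnorm_transpose: 
  assumes "A \<in> carrier_mat m m" shows "mnorm (transpose_mat A) = mnorm A"
  using assms by (subst (1 2) mnorm_carrier[of _ m]) (auto intro: sum.swap)

lemma mnorm_cnj: "mnorm (map_mat cnj A) = mnorm A"
  by (simp add: mnorm_def)

lemma mnorm_adj: "A \<in> carrier_mat m m \<Longrightarrow> mnorm (adj_mat A) = mnorm A"
  using mnorm_transpose[of "map_mat cnj A" m] by (simp add: adj_mat_def mnorm_cnj)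

lemma mnorm_minus_commute:
  assumes "A \<in> carrier_mat m m" "B \<in> carrier_mat m m"
  shows "mnorm (A - B) = mnorm (B - A)"
  using assms by (subst (1 2) mnorm_carrier[of _ m]) (auto intro!: sum.cong simp: norm_minus_commute)

lemma minus_add_minus_mat:
  fixes A :: "'a::ab_group_add mat"
  assumes "A \<in> carrier_mat m m" "B \<in> carrier_mat m m" "C \<in> carrier_mat m m"
  shows "(A - B) + (B - C) = A - C"
  using assms by (intro eq_matI) auto

lemma mnorm_triangle_minus:
  assumes "A \<in> carrier_mat m m" "B \<in> carrier_mat m m" "C \<in> carrier_mat m m"
  shows "mnorm (A - C) \<le> mnorm (A - B) + mnorm (B - C)"
  using mnorm_triangle[of "A - B" m "B - C"] minus_add_minus_mat[OF assms] assms by simp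

lemma mnorm_zero [simp]: "mnorm (0\<^sub>m m m) = 0"
  by (simp add: mnorm_def)

lemma eq_if_mnorm_minus_le_0:
  assumes "A \<in> carrier_mat m m" "B \<in> carrier_mat m m" "mnorm (A - B) \<le> 0"
  shows "A = B"
proof (intro eq_matI)
  fix i j assume "i < dim_row B" "j < dim_col B"
  then have ij: "i < m" "j < m" using assms by auto
  have "cmod ((A - B) $$ (i,j)) \<le> 0"
    using order.trans[OF entry_le_mnorm[OF _ ij] assms(3)] assms by simp
  then show "A $$ (i,j) = B $$ (i,j)" using ij assms by simp
qed (use assms in auto)

lemma index_mult_mat_sum:
  assumes "A \<in> carrier_mat m m" "B \<in> carrier_mat m m" "i < m" "j < m"
  shows "(A * B) $$ (i,j) = (\<Sum>k<m. A $$ (i,k) * B $$ (k,j))"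
  using assms by (simp add: scalar_prod_def lessThan_atLeast0)

lemma mnorm_mult_le:
  assumes "A \<in> carrier_mat m m" "B \<in> carrier_mat m m"
  shows "mnorm (A * B) \<le> mnorm A * mnorm B"
proof -
  have "mnorm (A * B) = (\<Sum>i<m. \<Sum>j<m. cmod (\<Sum>k<m. A $$ (i,k) * B $$ (k,j)))"
    using assms by (subst mnorm_carrier[of _ m]) (auto simp: index_mult_mat_sum intro!: sum.cong simp del: index_mult_mat)
  also have "\<dots> \<le> (\<Sum>i<m. \<Sum>j<m. \<Sum>k<m. cmod (A $$ (i,k)) * cmod (B $$ (k,j)))"
    by (intro sum_mono order.trans[OF norm_sum]) (simp add: norm_mult)
  also have "\<dots> = (\<Sum>i<m. \<Sum>k<m. cmod (A $$ (i,k)) * (\<Sum>j<m. cmod (B $$ (k,j))))"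
    unfolding sum_distrib_left by (intro sum.cong refl sum.swap)
  also have "\<dots> \<le> (\<Sum>i<m. \<Sum>k<m. cmod (A $$ (i,k)) * mnorm B)"
    using assms(2) unfolding mnorm_carrier[OF assms(2)]
    by (intro sum_mono mult_left_mono member_le_sum[where f = "\<lambda>k. \<Sum>j<m. cmod (B $$ (k,j))"])
       (auto intro: sum_nonneg)
  also have "\<dots> = mnorm A * mnorm B"
    by (simp add: mnorm_carrier[OF assms(1)] sum_distrib_right)
  finally show ?thesis .
qed

text \<open>Positive exponents only: at exponent 0 the left side would be the norm of the identity,
  which is m rather than 1.\<close>

lemma mnorm_pow_Suc_le:
  assumes "A \<in> carrier_mat m m" 
  shows "mnorm (A ^\<^sub>m Suc k) \<le> mnorm A ^ Suc k"
proof (induction k)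
  case 0
  then show ?case using assms by simp
next
  case (Suc k)
  have "mnorm (A ^\<^sub>m Suc (Suc k)) \<le> mnorm (A ^\<^sub>m Suc k) * mnorm A"
    using mnorm_mult_le[OF pow_carrier_mat[OF assms] assms, of "Suc k"] by simp
  also have "\<dots> \<le> mnorm A ^ Suc k * mnorm A"
    by (intro mult_right_mono Suc mnorm_nonneg)
  finally show ?case by (simp add: mult_ac)
qed

text \<open>For a single entry exponent 0 is harmless, because the entries of the identity are at
  most 1. So the scalar series of exp (\<open>mnorm A\<close>) majorises every entry of
  \<open>mexp A\<close>.\<close>

lemma mnorm_pow_entry_le:
  assumes A: "A \<in> carrier_mat m m" and "i < m" "j < m"
  shows "cmod ((A ^\<^sub>m n) $$ (i,j)) \<le> mnorm A ^ n"
proof (cases n)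
  case 0
  then show ?thesis using assms by auto
next
  case (Suc k)
  then show ?thesis
    using order.trans[OF entry_le_mnorm[OF pow_carrier_mat[OF A] assms(2,3)] mnorm_pow_Suc_le[OF A, of k]]
    by simp
qed

text \<open>Noncommutative telescoping: with P = A^(n+1) and Q = B^(n+1), P A - Q B = P (A - B) + (P
  - Q) B. The outcome is the mean value bound for x^(n+1) on the ball of radius r.\<close>

lemma mnorm_pow_diff_le:
  assumes A: "A \<in> carrier_mat m m" and B: "B \<in> carrier_mat m m"
    and rA: "mnorm A \<le> r" and rB: "mnorm B \<le> r"
  shows "mnorm (A ^\<^sub>m Suc n - B ^\<^sub>m Suc n) \<le> real (Suc n) * r ^ n * mnorm (A - B)"
proof (induction n)
  case 0
  then show ?case using A B by simp
next
  case (Suc n)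
  have r0: "r \<ge> 0" using rA mnorm_nonneg[of A] by linarith
  let ?P = "A ^\<^sub>m Suc n" and ?Q = "B ^\<^sub>m Suc n"
  have PQ: "?P \<in> carrier_mat m m" "?Q \<in> carrier_mat m m" using A B by (auto intro: pow_carrier_mat)
  have AB: "A - B \<in> carrier_mat m m" "?P - ?Q \<in> carrier_mat m m" using A B PQ by auto
  have "A ^\<^sub>m Suc (Suc n) - B ^\<^sub>m Suc (Suc n) = ?P * A - ?Q * B" by simp
  also have "\<dots> = ?P * (A - B) + (?P - ?Q) * B"
    unfolding mult_minus_distrib_mat[OF PQ(1) A B] minus_mult_distrib_mat[OF PQ B]
    by (rule minus_add_minus_mat[symmetric]) (use PQ A B in auto)
  finally have "mnorm (A ^\<^sub>m Suc (Suc n) - B ^\<^sub>m Suc (Suc n)) 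
      \<le> mnorm (?P * (A - B)) + mnorm ((?P - ?Q) * B)"
    using mnorm_triangle[OF mult_carrier_mat[OF PQ(1) AB(1)] mult_carrier_mat[OF AB(2) B]] by simp
  also have "\<dots> \<le> mnorm ?P * mnorm (A - B) + mnorm (?P - ?Q) * mnorm B"
    by (intro add_mono mnorm_mult_le[OF PQ(1) AB(1)] mnorm_mult_le[OF AB(2) B])
  also have "\<dots> \<le> r ^ Suc n * mnorm (A - B) + (real (Suc n) * r ^ n * mnorm (A - B)) * r"
  proof (intro add_mono mult_mono Suc rB)
    show "mnorm ?P \<le> r ^ Suc n"
      using mnorm_pow_Suc_le[OF A, of n] power_mono[OF rA mnorm_nonneg, of "Suc n"] by linarith
  qed (use r0 mnorm_nonneg in auto)
  also have "\<dots> = real (Suc (Suc n)) * r ^ Suc n * mnorm (A - B)"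
    by (simp add: algebra_simps)
  finally show ?case .
qed

lemma pow_mat_add:
  assumes "A \<in> carrier_mat m m"
  shows "A ^\<^sub>m (p + q) = A ^\<^sub>m p * A ^\<^sub>m q"
proof (induction q)
  case 0
  then show ?case using assms pow_carrier_mat[OF assms] by simp
next
  case (Suc q)
  then show ?case
    using assoc_mult_mat[OF pow_carrier_mat[OF assms] pow_carrier_mat[OF assms] assms] by simp
qed

section \<open>Convergence and local estimates of the matrix exponential\<close>

lemma mexp_carrier [simp]: "A \<in> carrier_mat m m \<Longrightarrow> mexp A \<in> carrier_mat m m"
  by (auto simp: mexp_def)

lemma mexp_index:
  assumes "A \<in> carrier_mat m m" "i < m" "j < m"
  shows "mexp A $$ (i,j) = (\<Sum>n. (A ^\<^sub>m n) $$ (i,j) / of_real (fact n))"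
  using assms by (simp add: mexp_def)

lemma summable_norm_mexp:
  assumes "A \<in> carrier_mat m m" "i < m" "j < m"
  shows "summable (\<lambda>n. cmod ((A ^\<^sub>m n) $$ (i,j) / of_real (fact n)))"
proof (rule summable_comparison_test')
  show "summable (\<lambda>n. inverse (fact n) * mnorm A ^ n)" by (rule summable_exp)
  fix n :: nat assume "n \<ge> 0"
  show "norm (cmod ((A ^\<^sub>m n) $$ (i,j) / of_real (fact n))) \<le> inverse (fact n) * mnorm A ^ n"
    using mnorm_pow_entry_le[OF assms, of n] by (simp add: norm_divide divide_simps)
qed

lemma summable_mexp:
  fixes A :: "complex mat"
  assumes "A \<in> carrier_mat m m" "i < m" "j < m"
  shows "summable (\<lambda>n. (A ^\<^sub>m n) $$ (i,j) / of_real (fact n))"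
  using summable_norm_mexp[OF assms] by (rule summable_norm_cancel)

lemma mnorm_suminf_le:
  assumes X: "\<And>n. X n \<in> carrier_mat m m" and le: "\<And>n. mnorm (X n) \<le> c n" and c: "summable c"
  shows "mnorm (Matrix.mat m m (\<lambda>(i,j). \<Sum>n. X n $$ (i,j))) \<le> suminf c"
proof -
  have s: "summable (\<lambda>n. cmod (X n $$ (i,j)))" if "i < m" "j < m" for i j
    using entry_le_mnorm[OF X that] le by (intro summable_comparison_test'[OF c]) (auto intro: order.trans)
  have "mnorm (Matrix.mat m m (\<lambda>(i,j). \<Sum>n. X n $$ (i,j))) 
      = (\<Sum>i<m. \<Sum>j<m. cmod (\<Sum>n. X n $$ (i,j)))"
    by (subst mnorm_carrier[of _ m]) auto
  also have "\<dots> \<le> (\<Sum>i<m. \<Sum>j<m. \<Sum>n. cmod (X n $$ (i,j)))"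
    using s by (intro sum_mono summable_norm) auto
  also have "\<dots> = (\<Sum>n. \<Sum>i<m. \<Sum>j<m. cmod (X n $$ (i,j)))"
    using s by (subst suminf_sum) (auto intro!: summable_sum sum.cong suminf_sum[symmetric])
  also have "\<dots> \<le> suminf c"
    using le X s c by (intro suminf_le summable_sum) (auto simp: mnorm_carrier[of _ m])
  finally show ?thesis .
qed

text \<open>Order 0 cancels and order 1 is A - B, so only the orders k >= 2 remain. Order k
  contributes at most k r^(k-1) / k! times \<open>mnorm (A - B)\<close>, and these factors add up to
  exp r - 1. For small r this makes \<open>mexp\<close> a small perturbation of the identity map up
  to a constant; the local logarithm rests on it.\<close>

lemma mexp_diff_le:
  assumes A: "A \<in> carrier_mat m m" and B: "B \<in> carrier_mat m m"
    and rA: "mnorm A \<le> r" and rB: "mnorm B \<le> r"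
  shows "mnorm ((mexp A - mexp B) - (A - B)) \<le> (exp r - 1) * mnorm (A - B)"
proof -
  define X where "X n = of_real (inverse (fact (n+2))) \<cdot>\<^sub>m (A ^\<^sub>m (n+2) - B ^\<^sub>m (n+2))" for n
  define c where "c n = (inverse (fact (Suc n)) * r ^ Suc n) * mnorm (A - B)" for n
  have X: "X n \<in> carrier_mat m m" for n using A B by (auto simp: X_def simp del: pow_mat.simps intro!: minus_carrier_mat pow_carrier_mat)
  have le: "mnorm (X n) \<le> c n" for n
  proof -
    have "mnorm (X n) = inverse (fact (n+2)) * mnorm (A ^\<^sub>m (n+2) - B ^\<^sub>m (n+2))"
      unfolding X_def mnorm_smult by (simp add: norm_inverse del: fact_Suc pow_mat.simps)
    also have "\<dots> \<le> inverse (fact (n+2)) * (real (Suc (Suc n)) * r ^ Suc n * mnorm (A - B))"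
      using mnorm_pow_diff_le[OF A B rA rB, of "Suc n"] by (intro mult_left_mono) auto
    also have "\<dots> = inverse (fact (Suc (Suc n))) * real (Suc (Suc n)) * (r ^ Suc n * mnorm (A - B))"
      by (simp del: fact_Suc)
    also have "inverse (fact (Suc (Suc n))) * real (Suc (Suc n)) = inverse (fact (Suc n))"
      using fact_Suc[of "Suc n", where 'a = real] by (simp del: fact_Suc of_nat_Suc)
    finally show ?thesis by (simp add: c_def)
  qed
  have "(\<lambda>n. inverse (fact n) * r ^ n) sums exp r"
    using exp_converges[of r] by (simp add: scaleR_conv_of_real)
  then have "(\<lambda>n. inverse (fact (Suc n)) * r ^ Suc n) sums (exp r - 1)"
    by (subst sums_Suc_iff) simp
  then have c: "c sums ((exp r - 1) * mnorm (A - B))"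
    unfolding c_def by (rule sums_mult2)
  have "(mexp A - mexp B) - (A - B) = Matrix.mat m m (\<lambda>(i,j). \<Sum>n. X n $$ (i,j))"
  proof (intro eq_matI)
    fix i j assume "i < dim_row (Matrix.mat m m (\<lambda>(i,j). \<Sum>n. X n $$ (i,j)))" 
      "j < dim_col (Matrix.mat m m (\<lambda>(i,j). \<Sum>n. X n $$ (i,j)))"
    then have ij: "i < m" "j < m" by auto
    define a where "a = (\<lambda>n. (A ^\<^sub>m n) $$ (i,j) / of_real (fact n))"
    define b where "b = (\<lambda>n. (B ^\<^sub>m n) $$ (i,j) / of_real (fact n))"
    have sab: "summable a" "summable b" unfolding a_def b_def
      using summable_mexp[OF A ij] summable_mexp[OF B ij] by auto
    then have s: "summable (\<lambda>n. a n - b n)" by (rule summable_diff)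
    have "mexp A $$ (i,j) - mexp B $$ (i,j) = (\<Sum>n. a n - b n)"
      using suminf_diff[OF sab] ij A B by (simp add: mexp_index[of _ m] a_def b_def)
    also have "\<dots> = (\<Sum>n. a (n+2) - b (n+2)) + (\<Sum>n<2. a n - b n)"
      by (rule suminf_split_initial_segment[OF s])
    also have "(\<Sum>n<2. a n - b n) = A $$ (i,j) - B $$ (i,j)"
      using A B ij by (simp add: a_def b_def numeral_2_eq_2)
    also have "(\<lambda>n. a (n+2) - b (n+2)) = (\<lambda>n. X n $$ (i,j))"
    proof
      fix n
      have "A ^\<^sub>m (n+2) \<in> carrier_mat m m" "B ^\<^sub>m (n+2) \<in> carrier_mat m m"
        using A B by (auto intro!: pow_carrier_mat simp del: pow_mat.simps)
      from this[THEN carrier_matD(1)] this[THEN carrier_matD(2)]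
      show "a (n+2) - b (n+2) = X n $$ (i,j)"
        using ij unfolding X_def a_def b_def
        by (simp add: divide_inverse algebra_simps of_real_inverse del: pow_mat.simps fact_Suc)
    qed
    finally show "((mexp A - mexp B) - (A - B)) $$ (i,j) = Matrix.mat m m (\<lambda>(i,j). \<Sum>n. X n $$ (i,j)) $$ (i,j)"
      using A B ij carrier_matD[OF mexp_carrier[OF A]] carrier_matD[OF mexp_carrier[OF B]] by simp
  qed (use A B carrier_matD[OF mexp_carrier[OF A]] carrier_matD[OF mexp_carrier[OF B]] in auto)
  then show ?thesis
    using mnorm_suminf_le[of X m c, OF X le] c by (simp add: sums_iff)
qed

lemma mexp_lipschitz:
  assumes A: "A \<in> carrier_mat m m" and B: "B \<in> carrier_mat m m"
    and rA: "mnorm A \<le> r" and rB: "mnorm B \<le> r"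
  shows "mnorm (mexp A - mexp B) \<le> exp r * mnorm (A - B)"
proof -
  have "mexp A - mexp B = ((mexp A - mexp B) - (A - B)) + (A - B)"
    using A B carrier_matD[OF mexp_carrier[OF A]] carrier_matD[OF mexp_carrier[OF B]]
    by (intro eq_matI) auto
  then have "mnorm (mexp A - mexp B) \<le> mnorm ((mexp A - mexp B) - (A - B)) + mnorm (A - B)"
    using mnorm_triangle[of "(mexp A - mexp B) - (A - B)" m "A - B"] A B mexp_carrier[OF B]
      minus_carrier_mat by metis
  also have "\<dots> \<le> (exp r - 1) * mnorm (A - B) + mnorm (A - B)"
    using mexp_diff_le[OF assms] by simp
  finally show ?thesis by (simp add: algebra_simps)
qed

section \<open>Adjoints, symmetries and the addition law of the exponential\<close>

lemma adj_index: "i < dim_col A \<Longrightarrow> j < dim_row A \<Longrightarrow> adj_mat A $$ (i,j) = cnj (A $$ (j,i))"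
  by (simp add: adj_mat_def)

lemma adj_carrier [simp]: "A \<in> carrier_mat m m \<Longrightarrow> adj_mat A \<in> carrier_mat m m"
  by (simp add: adj_mat_def)

lemma adj_adj [simp]: "adj_mat (adj_mat A) = A"
  by (intro eq_matI) (auto simp: adj_mat_def)

lemma cnj_mult:
  assumes "A \<in> carrier_mat m m" "B \<in> carrier_mat m m"
  shows "map_mat cnj (A * B) = map_mat cnj A * map_mat cnj B"
  using assms by (intro eq_matI) (auto simp: scalar_prod_def)

lemma adj_mult:
  assumes "A \<in> carrier_mat m m" "B \<in> carrier_mat m m"
  shows "adj_mat (A * B) = adj_mat B * adj_mat A"
  using assms by (simp add: adj_mat_def cnj_mult[of _ m] transpose_mult[of _ m m _ m])

lemma adj_one [simp]: "adj_mat (1\<^sub>m m) = 1\<^sub>m m"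
  by (intro eq_matI) (auto simp: adj_mat_def)

lemma mexp_zero [simp]: "mexp (0\<^sub>m m m) = 1\<^sub>m m"
proof -
  have z: "(0\<^sub>m m m) ^\<^sub>m Suc n = (0\<^sub>m m m :: complex mat)" for n 
    using right_mult_zero_mat[OF pow_carrier_mat[OF zero_carrier_mat, of m n], of m] by simp
  have "(\<Sum>n. ((0\<^sub>m m m :: complex mat) ^\<^sub>m n) $$ (i,j) / of_real (fact n)) = 1\<^sub>m m $$ (i,j)"
    if ij: "i < m" "j < m" for i j
  proof -
    have "((0\<^sub>m m m :: complex mat) ^\<^sub>m n) $$ (i,j) / of_real (fact n) = 0" if "n \<notin> {0}" for n
      using that z ij by (cases n) (auto simp del: pow_mat.simps(2))
    then show ?thesis by (subst suminf_finite[of "{0}"]) (use ij in auto)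
  qed
  then show ?thesis
    using carrier_matD[OF mexp_carrier[OF zero_carrier_mat[of m m]]]
    by (intro eq_matI) (auto simp: mexp_index[of _ m])
qed

text \<open>The relation T A = B T passes to all powers and then to the series. It is applied with T
  = \<epsilon>, A = \<open>flip X\<close> and B the transpose of X.\<close>

lemma mexp_intertwine:
  assumes A: "A \<in> carrier_mat m m" and B: "B \<in> carrier_mat m m" and T: "T \<in> carrier_mat m m"
    and TA: "T * A = B * T"
  shows "T * mexp A = mexp B * T"
proof -
  have p: "T * A ^\<^sub>m n = B ^\<^sub>m n * T" for n
  proof (induction n)
    case 0 then show ?case using A B T by simp
  next
    case (Suc n)
    have AB: "A ^\<^sub>m n \<in> carrier_mat m m" "B ^\<^sub>m n \<in> carrier_mat m m" using A B by (auto intro: pow_carrier_mat)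
    have "T * A ^\<^sub>m Suc n = (T * A ^\<^sub>m n) * A" using assoc_mult_mat[OF T AB(1) A] by simp
    also have "\<dots> = B ^\<^sub>m n * (T * A)" unfolding Suc by (rule assoc_mult_mat[OF AB(2) T A])
    also have "\<dots> = B ^\<^sub>m Suc n * T" using assoc_mult_mat[OF AB(2) B T] by (simp add: TA)
    finally show ?case .
  qed
  show ?thesis
  proof (intro eq_matI)
    fix i j assume "i < dim_row (mexp B * T)" "j < dim_col (mexp B * T)"
    then have ij: "i < m" "j < m" using B T by (auto simp: mexp_def)
    have "(T * mexp A) $$ (i,j) = (\<Sum>k<m. T $$ (i,k) * (\<Sum>n. (A ^\<^sub>m n) $$ (k,j) / of_real (fact n)))"
      using A T ij by (simp add: index_mult_mat_sum[of _ m] mexp_index[of _ m] del: index_mult_mat)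
    also have "\<dots> = (\<Sum>n. \<Sum>k<m. T $$ (i,k) * ((A ^\<^sub>m n) $$ (k,j) / of_real (fact n)))"
      using summable_mexp[OF A _ ij(2)] 
      by (subst suminf_sum) (auto intro!: summable_mult sum.cong suminf_mult[symmetric] simp del: times_divide_eq_right)
    also have "\<dots> = (\<Sum>n. (T * A ^\<^sub>m n) $$ (i,j) / of_real (fact n))"
      using A T ij pow_carrier_mat[OF A]
      by (simp add: index_mult_mat_sum[of _ m] sum_divide_distrib del: index_mult_mat)
    also have "\<dots> = (\<Sum>n. (B ^\<^sub>m n * T) $$ (i,j) / of_real (fact n))" by (simp only: p)
    also have "\<dots> = (\<Sum>n. \<Sum>k<m. ((B ^\<^sub>m n) $$ (i,k) / of_real (fact n)) * T $$ (k,j))"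
      using B T ij pow_carrier_mat[OF B]
      by (simp add: index_mult_mat_sum[of _ m] sum_divide_distrib del: index_mult_mat)
    also have "\<dots> = (\<Sum>k<m. (\<Sum>n. (B ^\<^sub>m n) $$ (i,k) / of_real (fact n)) * T $$ (k,j))"
      using summable_mexp[OF B ij(1)] 
      by (subst suminf_sum) (auto intro!: summable_mult2 sum.cong suminf_mult2[symmetric] simp del: times_divide_eq_left)
    also have "\<dots> = (mexp B * T) $$ (i,j)"
      using B T ij by (simp add: index_mult_mat_sum[of _ m] mexp_index[of _ m] del: index_mult_mat)
    finally show "(T * mexp A) $$ (i,j) = (mexp B * T) $$ (i,j)" .
  qed (use A B T in \<open>auto simp: mexp_def\<close>)
qed

lemma mexp_transpose:
  assumes A: "A \<in> carrier_mat m m"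
  shows "mexp (transpose_mat A) = transpose_mat (mexp A)"
proof -
  have "(transpose_mat A) ^\<^sub>m n = transpose_mat (A ^\<^sub>m n)" for n
  proof (induction n)
    case 0 then show ?case using A by simp
  next
    case (Suc n)
    have AB: "A ^\<^sub>m n \<in> carrier_mat m m" using A by (auto intro: pow_carrier_mat)
    have "transpose_mat A ^\<^sub>m Suc n = transpose_mat (A * A ^\<^sub>m n)"
      using transpose_mult[OF A AB] by (simp add: Suc)
    also have "A * A ^\<^sub>m n = A ^\<^sub>m Suc n"
      using pow_mat_add[OF A, of 1 n] A by simp 
    finally show ?case .
  qed
  then show ?thesis using A pow_carrier_mat[OF A]
    by (intro eq_matI) (auto simp: mexp_def)
qed

lemma mexp_cnj:
  assumes A: "A \<in> carrier_mat m m"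
  shows "mexp (map_mat cnj A) = map_mat cnj (mexp A)"
proof -
  have p: "(map_mat cnj A) ^\<^sub>m n = map_mat cnj (A ^\<^sub>m n)" for n
  proof (induction n)
    case 0 then show ?case using A by (intro eq_matI) auto
  next
    case (Suc n)
    show ?case using A pow_carrier_mat[OF A, of n] by (simp add: Suc cnj_mult[of _ m])
  qed
  show ?thesis
  proof (intro eq_matI)
    fix i j assume "i < dim_row (map_mat cnj (mexp A))" "j < dim_col (map_mat cnj (mexp A))"
    then have ij: "i < m" "j < m" using A by (auto simp: mexp_def)
    have "mexp (map_mat cnj A) $$ (i,j) = (\<Sum>n. cnj ((A ^\<^sub>m n) $$ (i,j) / of_real (fact n)))"
      using A ij pow_carrier_mat[OF A] by (subst mexp_index[of _ m]) (auto simp: p)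
    also have "\<dots> = cnj (\<Sum>n. (A ^\<^sub>m n) $$ (i,j) / of_real (fact n))"
      using sums_cnj[THEN iffD2, OF summable_sums[OF summable_mexp[OF A ij]]] by (rule sums_unique[symmetric])
    finally show "mexp (map_mat cnj A) $$ (i,j) = map_mat cnj (mexp A) $$ (i,j)"
      using A ij carrier_matD[OF mexp_carrier[OF A]] by (simp add: mexp_index[of A m])
  qed (use A in \<open>auto simp: mexp_def\<close>)
qed

lemma mexp_adj: "A \<in> carrier_mat m m \<Longrightarrow> mexp (adj_mat A) = adj_mat (mexp A)"
  using mexp_transpose[of "map_mat cnj A" m] by (simp add: adj_mat_def mexp_cnj[of _ m])

lemma smult_pow_mat:
  assumes A: "A \<in> carrier_mat m m"
  shows "(c \<cdot>\<^sub>m A) ^\<^sub>m n = c ^ n \<cdot>\<^sub>m (A ^\<^sub>m n :: complex mat)"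
proof (induction n)
  case 0 then show ?case using A by (intro eq_matI) auto
next
  case (Suc n)
  have [simp]: "A ^\<^sub>m n \<in> carrier_mat m m" using A by (rule pow_carrier_mat)
  have "(c \<cdot>\<^sub>m A) ^\<^sub>m Suc n = (c ^ n \<cdot>\<^sub>m A ^\<^sub>m n) * (c \<cdot>\<^sub>m A)" by (simp add: Suc)
  also have "\<dots> = c ^ Suc n \<cdot>\<^sub>m A ^\<^sub>m Suc n"
    using A by (simp add: mult_smult_assoc_mat[of _ m m _ m] mult_smult_distrib[of _ m m _ m])
      (intro eq_matI, auto)
  finally show ?case .
qed

text \<open>Both exponents are multiples of one matrix, so A^p A^q = A^(p+q), and the binomial
  theorem evaluates each diagonal of the Cauchy product. The Cauchy products are those of scalar
  series, one for each intermediate index k of the matrix product.\<close>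

lemma mexp_add_smult:
  assumes A: "A \<in> carrier_mat m m"
  shows "mexp (a \<cdot>\<^sub>m A) * mexp (b \<cdot>\<^sub>m A) = mexp ((a + b) \<cdot>\<^sub>m A)"
proof (intro eq_matI)
  fix i j assume "i < dim_row (mexp ((a + b) \<cdot>\<^sub>m A))" "j < dim_col (mexp ((a + b) \<cdot>\<^sub>m A))"
  then have ij: "i < m" "j < m" using A by (auto simp: mexp_def)
  have cA: "c \<cdot>\<^sub>m A \<in> carrier_mat m m" for c using A by simp
  have Ap[simp]: "A ^\<^sub>m n \<in> carrier_mat m m" for n using A by (rule pow_carrier_mat)
  define f where "f c n i j = ((c \<cdot>\<^sub>m A) ^\<^sub>m n) $$ (i,j) / of_real (fact n)" for c n i j
  have f: "f c n i j = c ^ n / of_real (fact n) * (A ^\<^sub>m n) $$ (i,j)" if "i < m" "j < m" for c n i j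
    using that Ap[of n] A unfolding f_def by (subst smult_pow_mat[OF A]) (simp add: carrier_matD[OF Ap])
  have conv: "(\<Sum>k<m. f a p i k * f b q k j) 
      = a ^ p / of_real (fact p) * (b ^ q / of_real (fact q)) * (A ^\<^sub>m (p + q)) $$ (i,j)" for p q
  proof -
    have "A ^\<^sub>m (p + q) = A ^\<^sub>m p * A ^\<^sub>m q" using A by (simp add: pow_mat_add[OF A])
    then show ?thesis using ij by (simp add: f index_mult_mat_sum[of _ m] sum_distrib_left mult_ac del: index_mult_mat)
  qed
  have sm: "summable (\<lambda>n. \<Sum>p\<le>n. f a p i k * f b (n - p) k j)" if "k < m" for k
    using Cauchy_product_sums[of "\<lambda>n. f a n i k" "\<lambda>n. f b n k j"]
      summable_norm_mexp[OF cA ij(1) that] summable_norm_mexp[OF cA that ij(2)]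
    unfolding f_def by (auto simp: sums_iff)
  have "(mexp (a \<cdot>\<^sub>m A) * mexp (b \<cdot>\<^sub>m A)) $$ (i,j) = (\<Sum>k<m. (\<Sum>n. f a n i k) * (\<Sum>n. f b n k j))"
    using ij cA by (simp add: index_mult_mat_sum[of _ m] mexp_index[OF cA] f_def del: index_mult_mat)
  also have "\<dots> = (\<Sum>k<m. \<Sum>n. \<Sum>p\<le>n. f a p i k * f b (n - p) k j)"
    using summable_norm_mexp[OF cA] ij by (intro sum.cong Cauchy_product refl) (auto simp: f_def)
  also have "\<dots> = (\<Sum>n. \<Sum>k<m. \<Sum>p\<le>n. f a p i k * f b (n - p) k j)"
    using sm by (subst suminf_sum) auto
  also have "\<dots> = (\<Sum>n. f (a + b) n i j)"
  proof (rule suminf_cong)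
    fix n
    have "(\<Sum>k<m. \<Sum>p\<le>n. f a p i k * f b (n - p) k j) = (\<Sum>p\<le>n. \<Sum>k<m. f a p i k * f b (n - p) k j)"
      by (rule sum.swap)
    also have "\<dots> = (\<Sum>p\<le>n. a ^ p / of_real (fact p) * (b ^ (n - p) / of_real (fact (n - p)))) * (A ^\<^sub>m n) $$ (i,j)"
      by (simp add: conv sum_distrib_right)
    also have "(\<Sum>p\<le>n. a ^ p / of_real (fact p) * (b ^ (n - p) / of_real (fact (n - p)))) = (a + b) ^ n / of_real (fact n)"
      by (simp add: binomial_ring sum_divide_distrib binomial_fact field_simps)
    finally show "(\<Sum>k<m. \<Sum>p\<le>n. f a p i k * f b (n - p) k j) = f (a + b) n i j"
      using ij by (simp add: f)
  qed
  also have "\<dots> = mexp ((a + b) \<cdot>\<^sub>m A) $$ (i,j)"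
    using ij by (simp add: mexp_index[OF cA] f_def)
  finally show "(mexp (a \<cdot>\<^sub>m A) * mexp (b \<cdot>\<^sub>m A)) $$ (i,j) = mexp ((a + b) \<cdot>\<^sub>m A) $$ (i,j)" .
qed (use A in \<open>auto simp: mexp_def\<close>)

lemma dim_mexp [simp]: "dim_row (mexp A) = dim_row A" "dim_col (mexp A) = dim_col A"
  by (simp_all add: mexp_def)

lemma mexp_smult_inverse:
  assumes "A \<in> carrier_mat m m"
  shows "mexp (c \<cdot>\<^sub>m A) * mexp ((- c) \<cdot>\<^sub>m A) = 1\<^sub>m m"
proof -
  have "0 \<cdot>\<^sub>m A = 0\<^sub>m m m" using assms by (intro eq_matI) auto
  then show ?thesis using mexp_add_smult[OF assms, of c "- c"] by simp
qed

section \<open>Local logarithm near the identity\<close>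

text \<open>Source of the radius 1/4: there exp r - 1 is at most 1/2, so \<open>mexp_diff_le\<close>
  yields the contraction factor 1/2.\<close>

lemma exp_quarter_le: "exp (1/4 :: real) \<le> 3/2"
  using exp_bound[of "1/4 :: real"] by (simp add: power2_eq_square)

lemma mexp_diff_le_half:
  assumes A: "A \<in> carrier_mat m m" and B: "B \<in> carrier_mat m m"
    and rA: "mnorm A \<le> 1/4" and rB: "mnorm B \<le> 1/4"
  shows "mnorm ((mexp A - mexp B) - (A - B)) \<le> mnorm (A - B) / 2"
proof -
  have "(exp (1/4) - 1) * mnorm (A - B) \<le> (1/2) * mnorm (A - B)"
    using exp_quarter_le by (intro mult_right_mono mnorm_nonneg) simp
  then show ?thesis using mexp_diff_le[OF assms] by simp
qed

text \<open>With D = A - B and E = \<open>mexp A - mexp B\<close>, |D| <= |E| + |E - D| <= |E| + |D|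
  / 2, and the last term is absorbed on the left. So the inverse of \<open>mexp\<close> has
  Lipschitz constant 2, which gives uniqueness, continuity and size of the logarithm.\<close>

lemma mnorm_diff_le_mexp_diff:
  assumes A: "A \<in> carrier_mat m m" and B: "B \<in> carrier_mat m m"
    and rA: "mnorm A \<le> 1/4" and rB: "mnorm B \<le> 1/4"
  shows "mnorm (A - B) \<le> 2 * mnorm (mexp A - mexp B)"
proof -
  let ?D = "A - B" and ?E = "mexp A - mexp B"
  have c: "?D \<in> carrier_mat m m" "?E \<in> carrier_mat m m" using A B by auto
  have "?D = ?E + (?D - ?E)" using c by (intro eq_matI) auto
  then have "mnorm ?D \<le> mnorm ?E + mnorm (?D - ?E)"
    using mnorm_triangle[of ?E m "?D - ?E"] c by simp
  also have "mnorm (?D - ?E) = mnorm (?E - ?D)" by (rule mnorm_minus_commute[OF c])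
  also have "\<dots> \<le> mnorm ?D / 2" by (rule mexp_diff_le_half[OF assms])
  finally show ?thesis by simp
qed

lemma mexp_inj:
  assumes "A \<in> carrier_mat m m" "B \<in> carrier_mat m m" "mnorm A \<le> 1/4" "mnorm B \<le> 1/4"
    and "mexp A = mexp B"
  shows "A = B"
proof -
  have "mexp A - mexp B = 0\<^sub>m m m" 
    using assms(5) mexp_carrier[OF assms(2)] by simp
  then show ?thesis
    using mnorm_diff_le_mexp_diff[OF assms(1-4)] by (intro eq_if_mnorm_minus_le_0[OF assms(1,2)]) simp
qed

lemma ex_mat_log:
  assumes U: "U \<in> carrier_mat m m" and small: "mnorm (U - 1\<^sub>m m) \<le> 1/8"
  shows "\<exists>A \<in> carrier_mat m m. mnorm A \<le> 1/4 \<and> mexp A = U"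
proof -
  \<comment> \<open>A logarithm of \<open>U\<close> is a fixed point of \<open>\<Phi>\<close>, a contraction of the ball of radius 1/4.\<close>
  define \<Phi> where "\<Phi> A = A + (U - mexp A)" for A
  define X where "X n = (\<Phi> ^^ n) (0\<^sub>m m m)" for n
  have X0: "X 0 = 0\<^sub>m m m" and XS: "X (Suc n) = \<Phi> (X n)" for n by (simp_all add: X_def)
  have X: "X n \<in> carrier_mat m m \<and> mnorm (X n) \<le> 1/4" for n
  proof (induction n)
    case 0 then show ?case by (simp add: X0)
  next
    case (Suc n)
    let ?A = "X n" and ?Z = "0\<^sub>m m m :: complex mat"
    have A: "?A \<in> carrier_mat m m" "mnorm ?A \<le> 1/4" using Suc by auto
    have eA: "mexp ?A \<in> carrier_mat m m" using A by simp
    \<comment> \<open>Comparison with the exponent 0: the first summand is at most 1/8 and the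
      remainder at most half of 1/4, so the iterates stay within 1/4. This fixes the constant 1/8 of
      the hypothesis.\<close>
    have "\<Phi> ?A = (U - 1\<^sub>m m) + (- ((mexp ?A - mexp ?Z) - (?A - ?Z)))"
      using A(1) U eA unfolding \<Phi>_def by (intro eq_matI) auto
    moreover have "(mexp ?A - mexp ?Z) - (?A - ?Z) \<in> carrier_mat m m" using A(1) by simp
    ultimately have "mnorm (\<Phi> ?A) \<le> mnorm (U - 1\<^sub>m m) + mnorm ((mexp ?A - mexp ?Z) - (?A - ?Z))"
      using mnorm_triangle[of "U - 1\<^sub>m m" m "- ((mexp ?A - mexp ?Z) - (?A - ?Z))"] U mnorm_uminus
      by (simp add: uminus_carrier_mat)
    also have "\<dots> \<le> 1/8 + mnorm (?A - ?Z) / 2"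
      using mexp_diff_le_half[OF A(1) zero_carrier_mat A(2)] small by (intro add_mono) auto
    also have "?A - ?Z = ?A" using A(1) by (intro eq_matI) auto
    finally show ?case using A eA U by (simp add: XS \<Phi>_def)
  qed
  then have Xc: "X n \<in> carrier_mat m m" and Xn: "mnorm (X n) \<le> 1/4" for n by auto
  have step: "X (Suc n) - X n = U - mexp (X n)" for n
    using Xc[of n] U mexp_carrier[OF Xc[of n]] unfolding XS \<Phi>_def by (intro eq_matI) auto
  have diff: "mnorm (X (Suc n) - X n) \<le> (1/2) ^ n" for n
  proof (induction n)
    case 0
    then show ?case using small unfolding step by (simp add: X0)
  next
    case (Suc n)
    let ?A = "X (Suc n)" and ?B = "X n"
    \<comment> \<open>By \<open>step\<close> the new increment is minus the remainder of
      \<open>mexp\<close> between consecutive iterates, hence at most half of the previous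
      increment.\<close>
    have "X (Suc (Suc n)) - X (Suc n) = - ((mexp ?A - mexp ?B) - (?A - ?B))"
      using Xc[of n] U mexp_carrier[OF Xc[of n]] Xc[of "Suc n"] mexp_carrier[OF Xc[of "Suc n"]]
      unfolding step by (intro eq_matI) (auto simp: step)
    then have "mnorm (X (Suc (Suc n)) - X (Suc n)) \<le> mnorm (?A - ?B) / 2"
      using mexp_diff_le_half[OF Xc Xc Xn Xn] by (simp add: mnorm_uminus)
    then show ?case using Suc by simp
  qed
  have "convergent (\<lambda>n. X n $$ (i,j))" if ij: "i < m" "j < m" for i j
  proof -
    have "summable (\<lambda>n. X (Suc n) $$ (i,j) - X n $$ (i,j))"
    proof (rule summable_comparison_test')
      show "summable (\<lambda>n. (1/2 :: real) ^ n)" by (simp add: summable_geometric)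
      fix n :: nat
      have "X (Suc n) - X n \<in> carrier_mat m m" using Xc by simp
      from order.trans[OF entry_le_mnorm[OF this ij] diff]
      show "norm (X (Suc n) $$ (i,j) - X n $$ (i,j)) \<le> (1/2) ^ n"
        using ij Xc[of n] Xc[of "Suc n"] by simp
    qed
    then have "convergent (\<lambda>n. \<Sum>k<n. X (Suc k) $$ (i,j) - X k $$ (i,j))"
      by (simp add: summable_iff_convergent)
    then have "convergent (\<lambda>n. X n $$ (i,j) - X 0 $$ (i,j))"
      by (simp only: sum_lessThan_telescope[of "\<lambda>n. X n $$ (i,j)"])
    then show ?thesis using ij by (simp add: X0)
  qed
  then obtain L where L: "\<And>i j. i < m \<Longrightarrow> j < m \<Longrightarrow> (\<lambda>n. X n $$ (i,j)) \<longlonglongrightarrow> L i j"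
    unfolding convergent_def by metis
  define A where "A = Matrix.mat m m (\<lambda>(i,j). L i j)"
  have A: "A \<in> carrier_mat m m" by (simp add: A_def)
  have "(\<lambda>n. mnorm (X n)) \<longlonglongrightarrow> mnorm A"
    unfolding mnorm_carrier[OF Xc] mnorm_carrier[OF A]
    by (intro tendsto_sum tendsto_norm) (auto simp: A_def intro: L)
  then have An: "mnorm A \<le> 1/4" by (rule LIMSEQ_le_const2) (use Xn in auto)
  have AXc: "A - X n \<in> carrier_mat m m" for n using A Xc by simp
  have lim: "(\<lambda>n. mnorm (A - X n)) \<longlonglongrightarrow> 0"
  proof -
    have "(\<lambda>n. \<Sum>i<m. \<Sum>j<m. cmod (A $$ (i,j) - X n $$ (i,j))) \<longlonglongrightarrow> (\<Sum>i<m. \<Sum>j<m. cmod (L i j - L i j))"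
      by (intro tendsto_sum tendsto_norm tendsto_diff L) (auto simp: A_def)
    then show ?thesis unfolding mnorm_carrier[OF AXc] using A Xc carrier_matD[OF Xc] by simp
  qed
  \<comment> \<open>\<open>mexp (X n) - U\<close> is minus the n-th increment, hence small; the
    Lipschitz bound then moves from X n to the limit A.\<close>
  have bound: "mnorm (mexp A - U) \<le> 2 * mnorm (A - X n) + (1/2) ^ n" for n
  proof -
    have "mnorm (mexp A - U) \<le> mnorm (mexp A - mexp (X n)) + mnorm (mexp (X n) - U)"
      using A Xc U by (intro mnorm_triangle_minus[where m = m]) auto
    also have "mnorm (mexp A - mexp (X n)) \<le> exp (1/4) * mnorm (A - X n)"
      by (rule mexp_lipschitz[OF A Xc An Xn])
    also have "\<dots> \<le> 2 * mnorm (A - X n)"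
      using exp_quarter_le by (intro mult_right_mono mnorm_nonneg) simp
    also have "mnorm (mexp (X n) - U) = mnorm (U - mexp (X n))"
      using Xc U by (intro mnorm_minus_commute[where m = m]) auto
    also have "\<dots> \<le> (1/2) ^ n" using diff[of n] by (simp add: step)
    finally show ?thesis by simp
  qed
  have "(\<lambda>n. 2 * mnorm (A - X n) + (1/2) ^ n) \<longlonglongrightarrow> 2 * 0 + 0"
    by (intro tendsto_add tendsto_mult tendsto_const lim LIMSEQ_realpow_zero) auto
  then have "mnorm (mexp A - U) \<le> 2 * 0 + 0"
    by (rule LIMSEQ_le_const) (use bound in auto)
  then have "mexp A = U" using A U by (intro eq_if_mnorm_minus_le_0[where m = m]) auto
  then show ?thesis using A An by auto
qed

text \<open>Meaningful only if some such \<open>A\<close> exists, for instance if \<open>mnorm (U - 1) \<le> 1/8\<close>.\<close>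
definition mlog :: "complex mat \<Rightarrow> complex mat" where
  "mlog U = (SOME A. A \<in> carrier_mat (dim_row U) (dim_row U) \<and> mnorm A \<le> 1/4 \<and> mexp A = U)"

text \<open>The last bound compares the logarithm with 0, the logarithm of the identity. It shrinks
  with U - 1 and so leaves room for the growth of the norm under \<open>flip\<close> in
  \<open>family_log\<close>.\<close>

lemma mlog:
  assumes U: "U \<in> carrier_mat m m" and small: "mnorm (U - 1\<^sub>m m) \<le> 1/8"
  shows "mlog U \<in> carrier_mat m m" "mnorm (mlog U) \<le> 1/4" "mexp (mlog U) = U"
    "mnorm (mlog U) \<le> 2 * mnorm (U - 1\<^sub>m m)"
proof -
  have "\<exists>A. A \<in> carrier_mat m m \<and> mnorm A \<le> 1/4 \<and> mexp A = U"
    using ex_mat_log[OF assms] by blast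
  then have *: "mlog U \<in> carrier_mat m m \<and> mnorm (mlog U) \<le> 1/4 \<and> mexp (mlog U) = U"
    unfolding mlog_def carrier_matD(1)[OF U] by (rule someI_ex)
  then show "mlog U \<in> carrier_mat m m" "mnorm (mlog U) \<le> 1/4" "mexp (mlog U) = U" by auto
  moreover from this(1) have "mlog U - 0\<^sub>m m m = mlog U" by (intro eq_matI) auto
  ultimately show "mnorm (mlog U) \<le> 2 * mnorm (U - 1\<^sub>m m)"
    using mnorm_diff_le_mexp_diff[of "mlog U" m "0\<^sub>m m m"] by simp
qed

text \<open>Uniqueness in the ball replaces any computation with the chosen logarithm: a candidate
  only has to be small and to have the right exponential.\<close>

lemma mlog_eqI:
  assumes A: "A \<in> carrier_mat m m" and "mnorm A \<le> 1/4" "mexp A = U"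
  shows "mlog U = A"
proof -
  have d: "dim_row U = m" using assms mexp_carrier[OF A] by auto
  have "mlog U \<in> carrier_mat m m \<and> mnorm (mlog U) \<le> 1/4 \<and> mexp (mlog U) = U"
    unfolding mlog_def d by (rule someI[of _ A]) (use assms in blast)
  then show ?thesis using assms(2,3) by (intro mexp_inj[OF _ A]) auto
qed

section \<open>Continuity of matrix-valued maps\<close>

text \<open>This and \<open>cont_matI\<close> translate entrywise continuity into convergence in
  \<open>mnorm\<close> and back, as required for \<open>mexp\<close> and \<open>mlog\<close>, whose
  estimates are not entrywise.\<close>

lemma cont_mat_tendsto:
  assumes c: "cont_mat m S f" and f: "\<And>x. x \<in> S \<Longrightarrow> f x \<in> carrier_mat m m" and x: "x \<in> S"
  shows "((\<lambda>y. mnorm (f y - f x)) \<longlongrightarrow> 0) (at x within S)"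
proof -
  have "((\<lambda>y. \<Sum>i<m. \<Sum>j<m. cmod (f y $$ (i,j) - f x $$ (i,j))) \<longlongrightarrow>
    (\<Sum>i<m. \<Sum>j<m. cmod (f x $$ (i,j) - f x $$ (i,j)))) (at x within S)"
    using c x by (intro tendsto_sum tendsto_norm tendsto_diff tendsto_const)
      (auto simp: cont_mat_def continuous_on_def)
  moreover have "\<forall>\<^sub>F y in at x within S.
    (\<Sum>i<m. \<Sum>j<m. cmod (f y $$ (i,j) - f x $$ (i,j))) = mnorm (f y - f x)"
    unfolding eventually_at_filter
  proof (intro always_eventually allI impI)
    fix y assume "y \<in> S"
    then have "f y \<in> carrier_mat m m" "f x \<in> carrier_mat m m" using f x by auto
    then show "(\<Sum>i<m. \<Sum>j<m. cmod (f y $$ (i,j) - f x $$ (i,j))) = mnorm (f y - f x)"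
      by (subst mnorm_carrier[of _ m]) (auto intro!: sum.cong)
  qed
  ultimately show ?thesis by (simp add: tendsto_cong)
qed

lemma cont_matI:
  assumes f: "\<And>x. x \<in> S \<Longrightarrow> f x \<in> carrier_mat m m"
    and r: "\<And>x. x \<in> S \<Longrightarrow> ((\<lambda>y. mnorm (f y - f x)) \<longlongrightarrow> 0) (at x within S)"
  shows "cont_mat m S f"
  unfolding cont_mat_def continuous_on_def
proof (intro allI impI ballI)
  fix i j x assume ij: "i < m" "j < m" and x: "x \<in> S"
  have "((\<lambda>y. f y $$ (i,j) - f x $$ (i,j)) \<longlongrightarrow> 0) (at x within S)"
  proof (rule Lim_null_comparison[OF _ r[OF x]])
    show "\<forall>\<^sub>F y in at x within S. norm (f y $$ (i,j) - f x $$ (i,j)) \<le> mnorm (f y - f x)"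
      unfolding eventually_at_filter
    proof (intro always_eventually allI impI)
      fix y assume "y \<in> S"
      then have "f y \<in> carrier_mat m m" "f x \<in> carrier_mat m m" using f x by auto
      then show "norm (f y $$ (i,j) - f x $$ (i,j)) \<le> mnorm (f y - f x)"
        using entry_le_mnorm[of "f y - f x" m i j] ij by simp
    qed
  qed
  then show "((\<lambda>y. f y $$ (i,j)) \<longlongrightarrow> f x $$ (i,j)) (at x within S)"
    by (simp add: LIM_zero_iff)
qed

lemma cont_mat_mexp:
  assumes f: "\<And>x. x \<in> S \<Longrightarrow> f x \<in> carrier_mat m m" and c: "cont_mat m S f"
  shows "cont_mat m S (\<lambda>x. mexp (f x))"
proof -
  have "((\<lambda>y. mnorm (mexp (f y) - mexp (f x))) \<longlongrightarrow> 0) (at x within S)" if x: "x \<in> S" for x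
  proof (rule Lim_null_comparison)
    \<comment> \<open>\<open>mexp\<close> is Lipschitz only on bounded sets; the ball of this radius
      contains f y for all y close to x.\<close>
    define r where "r = mnorm (f x) + 1"
    have l: "((\<lambda>y. mnorm (f y - f x)) \<longlongrightarrow> 0) (at x within S)"
      by (rule cont_mat_tendsto[OF c f x])
    from tendsto_mult[OF tendsto_const[of "exp r"] l]
    show "((\<lambda>y. exp r * mnorm (f y - f x)) \<longlongrightarrow> 0) (at x within S)" by simp
    have "\<forall>\<^sub>F y in at x within S. mnorm (f y - f x) < 1"
      using order_tendstoD(2)[OF l, of 1] by simp
    moreover have "\<forall>\<^sub>F y in at x within S. y \<in> S" by (simp add: eventually_at_filter)
    ultimately show "\<forall>\<^sub>F y in at x within S. norm (mnorm (mexp (f y) - mexp (f x))) \<le> exp r * mnorm (f y - f x)"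
    proof eventually_elim
      case (elim y)
      then have fc: "f y \<in> carrier_mat m m" "f x \<in> carrier_mat m m" using f x by auto
      have "f y = (f y - f x) + f x" using fc by (intro eq_matI) auto
      then have "mnorm (f y) \<le> mnorm (f y - f x) + mnorm (f x)"
        using mnorm_triangle[of "f y - f x" m "f x"] fc by simp
      then have "mnorm (f y) \<le> r" using elim by (simp add: r_def)
      then show ?case
        using mexp_lipschitz[OF fc] by (simp add: r_def mnorm_nonneg)
    qed
  qed
  then show ?thesis using f by (intro cont_matI) auto
qed

lemma cont_mat_mult:
  assumes f: "\<And>x. x \<in> S \<Longrightarrow> f x \<in> carrier_mat m m" and c: "cont_mat m S f"
    and g: "\<And>x. x \<in> S \<Longrightarrow> g x \<in> carrier_mat m m" and d: "cont_mat m S g"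
  shows "cont_mat m S (\<lambda>x. f x * g x)"
  unfolding cont_mat_def
proof (intro allI impI)
  fix i j assume ij: "i < m" "j < m"
  have "continuous_on S (\<lambda>x. \<Sum>k<m. f x $$ (i,k) * g x $$ (k,j))"
    using c d ij by (intro continuous_on_sum continuous_on_mult) (auto simp: cont_mat_def)
  then show "continuous_on S (\<lambda>x. (f x * g x) $$ (i,j))"
    using index_mult_mat_sum[OF f g ij] by (subst continuous_on_cong[OF refl]) auto
qed

lemma cont_mat_adj:
  assumes f: "\<And>x. x \<in> S \<Longrightarrow> f x \<in> carrier_mat m m" and c: "cont_mat m S f"
  shows "cont_mat m S (\<lambda>x. adj_mat (f x))"
  unfolding cont_mat_def
proof (intro allI impI)
  fix i j assume ij: "i < m" "j < m"
  have "continuous_on S (\<lambda>x. cnj (f x $$ (j,i)))"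
    using c ij by (intro continuous_on_cnj) (auto simp: cont_mat_def)
  then show "continuous_on S (\<lambda>x. adj_mat (f x) $$ (i,j))"
    using f ij by (subst continuous_on_cong[OF refl]) (auto simp: adj_index carrier_matD[OF f])
qed

lemma cont_mat_smult:
  assumes f: "\<And>x. x \<in> S \<Longrightarrow> f x \<in> carrier_mat m m" and c: "cont_mat m S f"
    and a: "continuous_on S a"
  shows "cont_mat m S (\<lambda>x. a x \<cdot>\<^sub>m f x)"
  unfolding cont_mat_def
proof (intro allI impI)
  fix i j assume ij: "i < m" "j < m"
  have "continuous_on S (\<lambda>x. a x * f x $$ (i,j))"
    using c ij a by (intro continuous_on_mult) (auto simp: cont_mat_def)
  then show "continuous_on S (\<lambda>x. (a x \<cdot>\<^sub>m f x) $$ (i,j))"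
    using ij by (subst continuous_on_cong[OF refl]) (auto simp: carrier_matD[OF f])
qed

lemma cont_mat_compose:
  assumes "cont_mat m T f" "continuous_on S g" "g ` S \<subseteq> T"
  shows "cont_mat m S (\<lambda>x. f (g x))"
  unfolding cont_mat_def
proof (intro allI impI)
  fix i j assume "i < m" "j < m"
  then have "continuous_on T (\<lambda>x. f x $$ (i,j))" using assms(1) by (simp add: cont_mat_def)
  from continuous_on_compose2[OF this assms(2,3)] show "continuous_on S (\<lambda>x. f (g x) $$ (i,j))" .
qed

lemma cont_mat_const [simp]: "cont_mat m S (\<lambda>x. A)"
  by (simp add: cont_mat_def)

lemma cont_mat_pow:
  assumes f: "\<And>x. x \<in> S \<Longrightarrow> f x \<in> carrier_mat m m" and c: "cont_mat m S f"
  shows "cont_mat m S (\<lambda>x. f x ^\<^sub>m n)"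
proof (induction n)
  case 0
  have "cont_mat m S (\<lambda>x. 1\<^sub>m m)" by simp
  then show ?case unfolding cont_mat_def
    using f by (auto simp: carrier_matD[OF f] cong: continuous_on_cong)
next
  case (Suc n)
  then show ?case using cont_mat_mult[OF pow_carrier_mat[OF f] Suc f c] by simp
qed

lemma cont_mat_mlog:
  assumes f: "\<And>x. x \<in> S \<Longrightarrow> f x \<in> carrier_mat m m" and c: "cont_mat m S f"
    and small: "\<And>x. x \<in> S \<Longrightarrow> mnorm (f x - 1\<^sub>m m) \<le> 1/8"
  shows "cont_mat m S (\<lambda>x. mlog (f x))"
proof -
  have "((\<lambda>y. mnorm (mlog (f y) - mlog (f x))) \<longlongrightarrow> 0) (at x within S)" if x: "x \<in> S" for x
  proof (rule Lim_null_comparison)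
    have l: "((\<lambda>y. mnorm (f y - f x)) \<longlongrightarrow> 0) (at x within S)"
      by (rule cont_mat_tendsto[OF c f x])
    from tendsto_mult[OF tendsto_const[of 2] l]
    show "((\<lambda>y. 2 * mnorm (f y - f x)) \<longlongrightarrow> 0) (at x within S)" by simp
    have "mnorm (mlog (f y) - mlog (f x)) \<le> 2 * mnorm (f y - f x)" if "y \<in> S" for y
      using mnorm_diff_le_mexp_diff[of "mlog (f y)" m "mlog (f x)"] mlog[OF f small] that x by simp
    then show "\<forall>\<^sub>F y in at x within S. norm (mnorm (mlog (f y) - mlog (f x))) \<le> 2 * mnorm (f y - f x)"
      by (auto simp: eventually_at_filter mnorm_nonneg)
  qed
  then show ?thesis using mlog(1)[OF f small] by (intro cont_matI) auto
qed

section \<open>Unitary matrices\<close>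

lemma unitary_carrier [simp]: "unitary_m m U \<Longrightarrow> U \<in> carrier_mat m m"
  by (simp add: unitary_m_def)

lemma unitary_one [simp]: "unitary_m m (1\<^sub>m m)"
  by (simp add: unitary_m_def)

lemma unitary_adj [simp]: "unitary_m m U \<Longrightarrow> unitary_m m (adj_mat U)"
  by (simp add: unitary_m_def)

lemma unitary_mult_adj [simp]: "unitary_m m U \<Longrightarrow> U * adj_mat U = 1\<^sub>m m"
  and unitary_adj_mult [simp]: "unitary_m m U \<Longrightarrow> adj_mat U * U = 1\<^sub>m m"
  by (simp_all add: unitary_m_def)

lemma mult_cancel_inner:
  fixes A :: "'a::semiring_1 mat"
  assumes "A \<in> carrier_mat m m" "B \<in> carrier_mat m m" "B' \<in> carrier_mat m m" "C \<in> carrier_mat m m"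
    and "B * B' = 1\<^sub>m m"
  shows "(A * B) * (B' * C) = A * C"
proof -
  have "(A * B) * (B' * C) = A * (B * (B' * C))"
    using assms by (intro assoc_mult_mat) auto
  also have "B * (B' * C) = C" using assms assoc_mult_mat[OF assms(2-4)] by simp
  finally show ?thesis .
qed

lemma unitary_mult [simp]:
  assumes U: "unitary_m m U" and V: "unitary_m m V"
  shows "unitary_m m (U * V)"
proof -
  note c = unitary_carrier[OF U] unitary_carrier[OF V] adj_carrier[OF unitary_carrier[OF U]] adj_carrier[OF unitary_carrier[OF V]]
  show ?thesis
    unfolding unitary_m_def adj_mult[OF c(1,2)]
    using c U V mult_cancel_inner[OF c(1,2,4,3)] mult_cancel_inner[OF c(4,3,1,2)] by simp
qed

lemma unitary_pow [simp]: "unitary_m m U \<Longrightarrow> unitary_m m (U ^\<^sub>m n)"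
  by (induction n) (auto simp: carrier_matD[OF unitary_carrier])

text \<open>The rows of a unitary matrix are Euclidean unit vectors, so each of the m^2 entries has
  modulus at most 1.\<close>

lemma mnorm_unitary_le:
  assumes U: "unitary_m m U"
  shows "mnorm U \<le> real m * real m"
proof -
  have "cmod (U $$ (i,j)) \<le> 1" if ij: "i < m" "j < m" for i j
  proof -
    have c: "U \<in> carrier_mat m m" "adj_mat U \<in> carrier_mat m m" using U by auto
    have "1 = (U * adj_mat U) $$ (i,i)" using U ij by simp
    also have "\<dots> = (\<Sum>k<m. of_real ((cmod (U $$ (i,k)))\<^sup>2))"
      unfolding index_mult_mat_sum[OF c ij(1) ij(1)] using ij
      by (intro sum.cong refl) (simp add: adj_index carrier_matD[OF c(1)] complex_norm_square[symmetric])
    finally have "of_real (\<Sum>k<m. (cmod (U $$ (i,k)))\<^sup>2) = (1 :: complex)" by simp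
    then have "(\<Sum>k<m. (cmod (U $$ (i,k)))\<^sup>2) = 1" using of_real_eq_1_iff by blast
    moreover have "(cmod (U $$ (i,j)))\<^sup>2 \<le> (\<Sum>k<m. (cmod (U $$ (i,k)))\<^sup>2)"
      using ij by (intro member_le_sum) auto
    ultimately show ?thesis using power2_le_imp_le[of "cmod (U $$ (i,j))" 1] by simp
  qed
  then show ?thesis using mnorm_le_entries[of U m 1] U by simp
qed

text \<open>Each unitary factor costs at most m^2. This is the origin of the factor m^4 in
  \<open>mesh\<close> and in the subdivision of the homotopy.\<close>

lemma mnorm_unitary_conj_le:
  assumes "unitary_m m V" "unitary_m m W" "X \<in> carrier_mat m m"
  shows "mnorm (V * X * W) \<le> real m ^ 4 * mnorm X"
proof -
  have "mnorm (V * X * W) \<le> mnorm (V * X) * mnorm W"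
    using assms by (intro mnorm_mult_le[where m = m]) auto
  also have "\<dots> \<le> mnorm V * mnorm X * mnorm W"
    using assms by (intro mult_right_mono mnorm_mult_le[where m = m] mnorm_nonneg) auto
  also have "\<dots> \<le> (real m * real m) * mnorm X * (real m * real m)"
    using mnorm_unitary_le assms by (intro mult_mono) (auto simp: mnorm_nonneg)
  finally show ?thesis by (simp add: power4_eq_xxxx mult_ac)
qed

lemma unitary_mexp:
  assumes H: "selfadj_m m H"
  shows "unitary_m m (mexp ((\<i> * of_real t) \<cdot>\<^sub>m H))"
    and adj_mexp_ii: "adj_mat (mexp ((\<i> * of_real t) \<cdot>\<^sub>m H)) = mexp ((\<i> * of_real (- t)) \<cdot>\<^sub>m H)"
proof -
  have c: "H \<in> carrier_mat m m" and h: "adj_mat H = H" using H by (auto simp: selfadj_m_def)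
  have "adj_mat ((\<i> * of_real t) \<cdot>\<^sub>m H) = (\<i> * of_real (- t)) \<cdot>\<^sub>m adj_mat H"
    using c by (intro eq_matI) (auto simp: adj_mat_def)
  then show adj: "adj_mat (mexp ((\<i> * of_real t) \<cdot>\<^sub>m H)) = mexp ((\<i> * of_real (- t)) \<cdot>\<^sub>m H)"
    using c h mexp_adj[of "(\<i> * of_real t) \<cdot>\<^sub>m H" m] by simp
  show "unitary_m m (mexp ((\<i> * of_real t) \<cdot>\<^sub>m H))"
    unfolding unitary_m_def adj
    using c mexp_smult_inverse[OF c, of "\<i> * of_real t"] mexp_smult_inverse[OF c, of "\<i> * of_real (- t)"] by simp
qed

section \<open>Time reversal as an anti-automorphism\<close>

text \<open>What the bosonic and the fermionic case share: \<epsilon> is real, orthogonal and, up to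
  the sign s, symmetric. The sign is 1 for the identity and -1 for \<open>Jsymp m\<close>.\<close>

locale time_reversal =
  fixes m :: nat and \<epsilon> :: "complex mat" and s :: complex
  assumes eps_carrier [simp]: "\<epsilon> \<in> carrier_mat m m"
    and eps_cnj: "map_mat cnj \<epsilon> = \<epsilon>"
    and eps_transpose: "transpose_mat \<epsilon> = s \<cdot>\<^sub>m \<epsilon>"
    and sign: "s * s = 1"
    and eps_mult_transpose [simp]: "\<epsilon> * transpose_mat \<epsilon> = 1\<^sub>m m"
begin

lemma eps_transpose_carrier [simp]: "transpose_mat \<epsilon> \<in> carrier_mat m m" by simp

lemma eps_transpose_mult [simp]: "transpose_mat \<epsilon> * \<epsilon> = 1\<^sub>m m"
  using eps_mult_transpose unfolding eps_transpose
  by (simp add: mult_smult_distrib[of _ m m _ m] mult_smult_assoc_mat[of _ m m _ m])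

lemma adj_eps: "adj_mat \<epsilon> = transpose_mat \<epsilon>" "adj_mat (transpose_mat \<epsilon>) = \<epsilon>"
proof -
  show "adj_mat \<epsilon> = transpose_mat \<epsilon>" by (simp add: adj_mat_def eps_cnj)
  then show "adj_mat (transpose_mat \<epsilon>) = \<epsilon>" using adj_adj by metis
qed

lemma eps_unitary: "unitary_m m \<epsilon>" "unitary_m m (transpose_mat \<epsilon>)"
  unfolding unitary_m_def adj_eps by simp_all

definition flip :: "complex mat \<Rightarrow> complex mat" where
  "flip X = transpose_mat \<epsilon> * transpose_mat X * \<epsilon>"

lemma flip_carrier [simp]: "X \<in> carrier_mat m m \<Longrightarrow> flip X \<in> carrier_mat m m"
  by (simp add: flip_def)

lemma flip_mult:
  assumes "X \<in> carrier_mat m m" "Y \<in> carrier_mat m m"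
  shows "flip (X * Y) = flip Y * flip X"
proof -
  have "flip Y * flip X = (transpose_mat \<epsilon> * transpose_mat Y * \<epsilon>) * (transpose_mat \<epsilon> * (transpose_mat X * \<epsilon>))"
    using assms assoc_mult_mat[of "transpose_mat \<epsilon>" m m "transpose_mat X" m \<epsilon> m] by (simp add: flip_def)
  also have "\<dots> = (transpose_mat \<epsilon> * transpose_mat Y) * (transpose_mat X * \<epsilon>)"
    using assms by (intro mult_cancel_inner[where m = m]) auto
  also have "\<dots> = transpose_mat \<epsilon> * transpose_mat Y * transpose_mat X * \<epsilon>"
    using assms by (intro assoc_mult_mat[symmetric, where n\<^sub>1 = m and n\<^sub>2 = m and n\<^sub>3 = m and n\<^sub>4 = m]) auto
  also have "transpose_mat \<epsilon> * transpose_mat Y * transpose_mat X = transpose_mat \<epsilon> * (transpose_mat Y * transpose_mat X)"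
    using assms by (intro assoc_mult_mat[where n\<^sub>1 = m and n\<^sub>2 = m and n\<^sub>3 = m and n\<^sub>4 = m]) auto
  also have "transpose_mat Y * transpose_mat X = transpose_mat (X * Y)"
    using assms by (intro transpose_mult[symmetric]) auto
  finally show ?thesis by (simp add: flip_def)
qed

lemma flip_one [simp]: "flip (1\<^sub>m m) = 1\<^sub>m m"
  by (simp add: flip_def right_mult_one_mat[of _ m m])

lemma flip_smult: "X \<in> carrier_mat m m \<Longrightarrow> flip (c \<cdot>\<^sub>m X) = c \<cdot>\<^sub>m flip X"
proof -
  assume X: "X \<in> carrier_mat m m"
  have "transpose_mat (c \<cdot>\<^sub>m X) = c \<cdot>\<^sub>m transpose_mat X" using X by (intro eq_matI) auto
  then show ?thesis using X 
    by (simp add: flip_def mult_smult_distrib[of _ m m _ m] mult_smult_assoc_mat[of _ m m _ m])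
qed

lemma sym_iff:
  assumes X: "X \<in> carrier_mat m m" and Y: "Y \<in> carrier_mat m m"
  shows "\<epsilon> * X = transpose_mat Y * \<epsilon> \<longleftrightarrow> X = flip Y"
proof
  have Yt: "transpose_mat Y \<in> carrier_mat m m" using Y by simp
  assume eq: "\<epsilon> * X = transpose_mat Y * \<epsilon>"
  have "X = (transpose_mat \<epsilon> * \<epsilon>) * X" using X by simp
  also have "\<dots> = transpose_mat \<epsilon> * (\<epsilon> * X)"
    by (rule assoc_mult_mat[OF eps_transpose_carrier eps_carrier X])
  also have "\<dots> = flip Y"
    unfolding eq flip_def by (rule assoc_mult_mat[OF eps_transpose_carrier Yt eps_carrier, symmetric])
  finally show "X = flip Y" .
next
  have Yt: "transpose_mat Y \<in> carrier_mat m m" using Y by simp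
  assume eq: "X = flip Y"
  have "\<epsilon> * X = \<epsilon> * (transpose_mat \<epsilon> * (transpose_mat Y * \<epsilon>))"
    unfolding eq flip_def assoc_mult_mat[OF eps_transpose_carrier Yt eps_carrier] ..
  also have "\<dots> = (\<epsilon> * transpose_mat \<epsilon>) * (transpose_mat Y * \<epsilon>)"
    by (rule assoc_mult_mat[OF eps_carrier eps_transpose_carrier mult_carrier_mat[OF Yt eps_carrier], symmetric])
  also have "\<dots> = transpose_mat Y * \<epsilon>"
    using left_mult_one_mat[OF mult_carrier_mat[OF Yt eps_carrier]] by simp
  finally show "\<epsilon> * X = transpose_mat Y * \<epsilon>" .
qed

text \<open>Transposing the relation that characterises \<open>flip X\<close> turns \<epsilon> into
  s times \<epsilon> on both sides. The two signs cancel, so the involution property holds for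
  either statistics.\<close>

lemma flip_flip [simp]:
  assumes X: "X \<in> carrier_mat m m"
  shows "flip (flip X) = X"
proof -
  have Xt: "transpose_mat X \<in> carrier_mat m m" using X by simp
  have "transpose_mat (\<epsilon> * flip X) = transpose_mat (transpose_mat X * \<epsilon>)"
    using sym_iff[OF flip_carrier[OF X] X] by simp
  then have "transpose_mat (flip X) * transpose_mat \<epsilon> = transpose_mat \<epsilon> * X"
    using transpose_mult[OF eps_carrier flip_carrier[OF X]] transpose_mult[OF Xt eps_carrier] by simp
  then have "s \<cdot>\<^sub>m (transpose_mat (flip X) * \<epsilon>) = s \<cdot>\<^sub>m (\<epsilon> * X)"
    unfolding eps_transpose using X
    by (simp add: mult_smult_distrib[of _ m m _ m] mult_smult_assoc_mat[of _ m m _ m])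
  then have "s \<cdot>\<^sub>m (s \<cdot>\<^sub>m (transpose_mat (flip X) * \<epsilon>)) = s \<cdot>\<^sub>m (s \<cdot>\<^sub>m (\<epsilon> * X))" by simp
  moreover have ss: "s \<cdot>\<^sub>m (s \<cdot>\<^sub>m A) = A" for A
    using sign by (intro eq_matI) (auto simp: mult.assoc[symmetric])
  ultimately have "\<epsilon> * X = transpose_mat (flip X) * \<epsilon>" by (simp only: ss)
  then show ?thesis using sym_iff[OF X flip_carrier[OF X]] by simp
qed

lemma adj_flip:
  assumes X: "X \<in> carrier_mat m m"
  shows "adj_mat (flip X) = flip (adj_mat X)"
proof -
  have Xt: "transpose_mat X \<in> carrier_mat m m" using X by simp
  have cX: "map_mat cnj X \<in> carrier_mat m m" using X by simp
  have "adj_mat (transpose_mat X) = map_mat cnj X" 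
    using X by (intro eq_matI) (auto simp: adj_mat_def)
  moreover have "transpose_mat (adj_mat X) = map_mat cnj X" by (simp add: adj_mat_def)
  ultimately show ?thesis
    unfolding flip_def adj_mult[OF mult_carrier_mat[OF eps_transpose_carrier Xt] eps_carrier]
      adj_mult[OF eps_transpose_carrier Xt] adj_eps
    using assoc_mult_mat[OF eps_transpose_carrier cX eps_carrier] by simp
qed

text \<open>The right-hand side is that of condition (c), since the inverse of \<epsilon> is its
  transpose. So (c) says that reversing both k_1 and k amounts to applying X ->
  \<open>flip (adj_mat X)\<close>.\<close>

lemma flip_adj_eq: "flip (adj_mat X) = transpose_mat \<epsilon> * map_mat cnj X * \<epsilon>"
  by (simp add: flip_def adj_mat_def)

lemma flip_pow:
  assumes X: "X \<in> carrier_mat m m"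
  shows "flip (X ^\<^sub>m n) = flip X ^\<^sub>m n"
proof (induction n)
  case 0
  then show ?case using X carrier_matD[OF flip_carrier[OF X]] by simp
next
  case (Suc n)
  have "X ^\<^sub>m Suc n = X * X ^\<^sub>m n" using pow_mat_add[OF X, of 1 n] X by simp
  then have "flip (X ^\<^sub>m Suc n) = flip (X ^\<^sub>m n) * flip X"
    using flip_mult[OF X pow_carrier_mat[OF X]] by simp
  then show ?case by (simp add: Suc)
qed

lemma mexp_flip:
  assumes X: "X \<in> carrier_mat m m"
  shows "mexp (flip X) = flip (mexp X)"
proof -
  have "\<epsilon> * mexp (flip X) = mexp (transpose_mat X) * \<epsilon>"
    using sym_iff[OF flip_carrier[OF X] X] X by (intro mexp_intertwine[where m = m]) auto
  then show ?thesis using sym_iff[of "mexp (flip X)" "mexp X"] X by (simp add: mexp_transpose[OF X])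
qed

lemma mnorm_flip_le: 
  assumes X: "X \<in> carrier_mat m m"
  shows "mnorm (flip X) \<le> real m ^ 4 * mnorm X"
  using mnorm_unitary_conj_le[OF eps_unitary(2,1), of "transpose_mat X"] X
  by (simp add: flip_def mnorm_transpose[OF X])

text \<open>The conditions common to matching families and to the exponents of a multi-step
  logarithm; unitarity and self-adjointness, which tell the two apart, are stated
  separately.\<close>

definition sym_family :: "('d::euclidean_space \<Rightarrow> complex mat) \<Rightarrow> bool" where
  "sym_family f \<longleftrightarrow> (\<forall>k. f k \<in> carrier_mat m m) \<and> cont_mat m UNIV f \<and> Zperiodic f \<and> (\<forall>k. flip (f (- k)) = f k)"

lemma sym_familyD:
  assumes "sym_family f"
  shows "f k \<in> carrier_mat m m" "cont_mat m UNIV f" "Zperiodic f" "flip (f (- k)) = f k"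
  using assms by (simp_all add: sym_family_def)

lemma sym_familyI:
  assumes "\<And>k. f k \<in> carrier_mat m m" "cont_mat m UNIV f" "Zperiodic f" "\<And>k. flip (f (- k)) = f k"
  shows "sym_family f"
  using assms by (simp add: sym_family_def)

lemma matching_family_iff:
  "matching_family m \<epsilon> \<alpha> \<longleftrightarrow> sym_family \<alpha> \<and> (\<forall>k. unitary_m m (\<alpha> k))"
  unfolding matching_family_def sym_family_def
  using sym_iff[OF unitary_carrier unitary_carrier] unitary_carrier by metis

lemma sym_family_conj:
  assumes V: "sym_family V" and a: "sym_family \<alpha>"
  shows "sym_family (\<lambda>k. V k * \<alpha> k * V k)"
proof -
  note c = sym_familyD(1)[OF V] sym_familyD(1)[OF a] and f = sym_familyD(4)[OF V] sym_familyD(4)[OF a]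
  show ?thesis
  proof (rule sym_familyI)
    show "flip (V (- k) * \<alpha> (- k) * V (- k)) = V k * \<alpha> k * V k" for k
      using assoc_mult_mat[OF c(1)[of k] c(2)[of k] c(1)[of k]]
      by (simp only: flip_mult[OF mult_carrier_mat[OF c(1) c(2)] c(1)] flip_mult[OF c(1) c(2)] f)
    show "cont_mat m UNIV (\<lambda>k. V k * \<alpha> k * V k)"
      using sym_familyD(2)[OF V] sym_familyD(2)[OF a] c by (intro cont_mat_mult) auto
    show "Zperiodic (\<lambda>k. V k * \<alpha> k * V k)"
      using sym_familyD(3)[OF V] sym_familyD(3)[OF a] by (simp add: Zperiodic_def)
  qed (use c in auto)
qed

lemma sym_family_mexp:
  assumes h: "sym_family h"
  shows "sym_family (\<lambda>k. mexp (c \<cdot>\<^sub>m h k))"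
proof -
  note hc = sym_familyD(1)[OF h] and f = sym_familyD(4)[OF h]
  show ?thesis
  proof (rule sym_familyI)
    show "cont_mat m UNIV (\<lambda>k. mexp (c \<cdot>\<^sub>m h k))"
      using hc sym_familyD(2)[OF h] by (intro cont_mat_mexp[where m = m] cont_mat_smult) auto
    show "flip (mexp (c \<cdot>\<^sub>m h (- k))) = mexp (c \<cdot>\<^sub>m h k)" for k
      using hc by (simp add: mexp_flip[symmetric] flip_smult f)
    show "Zperiodic (\<lambda>k. mexp (c \<cdot>\<^sub>m h k))"
      using sym_familyD(3)[OF h] by (simp add: Zperiodic_def)
  qed (use hc in auto)
qed

section \<open>Logarithms of families close to the identity\<close>

text \<open>Two demands meet here: at most 1/8, so that \<open>mlog\<close> applies, and m^4 times 2
  \<open>mesh\<close> at most 1/4, so that the logarithm, of norm at most 2 \<open>mesh\<close>,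
  stays in the ball of uniqueness after \<open>flip\<close>. The summand 1 keeps the denominator
  positive for every m.\<close>

definition mesh :: real where "mesh = 1 / (8 * (real m ^ 4 + 1))"

lemma mesh_pos: "mesh > 0" unfolding mesh_def by (simp add: add_nonneg_pos)

lemma mesh_le: "mesh \<le> 1/8" "real m ^ 4 * (2 * mesh) \<le> 1/4"
proof -
  have "0 \<le> real m ^ 4" "0 < real m ^ 4 + 1" by (simp_all add: add_nonneg_pos)
  then have f: "1 / (real m ^ 4 + 1) \<le> 1" "real m ^ 4 / (real m ^ 4 + 1) \<le> 1"
    by (simp_all add: divide_le_eq_1_pos)
  have "1 / (8 * y) = (1 / y) / 8" "x * (2 * (1 / (8 * y))) = (x / y) / 4" for x y :: real
    by simp_all
  then have e: "mesh = (1 / (real m ^ 4 + 1)) / 8" "real m ^ 4 * (2 * mesh) = (real m ^ 4 / (real m ^ 4 + 1)) / 4"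
    unfolding mesh_def by blast+
  show "mesh \<le> 1/8" unfolding e(1) by (rule divide_right_mono[OF f(1)]) simp
  show "real m ^ 4 * (2 * mesh) \<le> 1/4" unfolding e(2) by (rule divide_right_mono[OF f(2)]) simp
qed

text \<open>Uniqueness transfers the properties of \<alpha> to its logarithm L:
  \<open>flip (L (- k))\<close> and L k have the same exponential, and so have
  \<open>adj_mat (L k)\<close> and - L k, because \<alpha> k is unitary. Thus L is skew-adjoint, and
  h = - i L is self-adjoint.\<close>

lemma family_log:
  assumes a: "matching_family m \<epsilon> \<alpha>" and small: "\<And>k. mnorm (\<alpha> k - 1\<^sub>m m) \<le> mesh"
  obtains h where "sym_family h" "\<And>k. selfadj_m m (h k)" "\<And>k. mexp (\<i> \<cdot>\<^sub>m h k) = \<alpha> k"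
proof -
  have u: "unitary_m m (\<alpha> k)" for k using a by (simp add: matching_family_iff)
  have c: "\<alpha> k \<in> carrier_mat m m" for k using u by simp
  have f: "flip (\<alpha> (- k)) = \<alpha> k" for k using a by (simp add: matching_family_iff sym_familyD)
  have sm: "mnorm (\<alpha> k - 1\<^sub>m m) \<le> 1/8" for k using small[of k] mesh_le(1) by linarith
  define L where "L k = mlog (\<alpha> k)" for k
  note L = mlog[OF c sm, folded L_def]
  have flipL: "flip (L (- k)) = L k" for k
  proof -
    \<comment> \<open>The radius 1/4 itself may be lost under \<open>flip\<close>; the bound on L
      that is linear in the distance of \<alpha> from 1 is used instead.\<close>
    have "mnorm (flip (L (- k))) \<le> real m ^ 4 * (2 * mesh)"
      using L(4)[of "- k"] small[of "- k"]
      by (intro order.trans[OF mnorm_flip_le[OF L(1)]] mult_left_mono) auto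
    also have "\<dots> \<le> 1/4" by (rule mesh_le(2))
    finally show ?thesis
      unfolding L_def[of k] using L by (intro mlog_eqI[symmetric, where m = m]) (auto simp: mexp_flip f)
  qed
  have adjL: "adj_mat (L k) = - L k" for k
  proof (rule mexp_inj[where m = m])
    have m1: "- L k = (-1) \<cdot>\<^sub>m L k" by (intro eq_matI) auto
    have e1: "mexp (1 \<cdot>\<^sub>m L k) = \<alpha> k" 
    proof -
      have "1 \<cdot>\<^sub>m L k = L k" by (intro eq_matI) auto
      then show ?thesis using L(3) by simp
    qed
    have inv: "\<alpha> k * mexp (- L k) = 1\<^sub>m m"
      using mexp_smult_inverse[OF L(1), of 1 k] by (simp only: m1 e1)
    have eL: "mexp (- L k) \<in> carrier_mat m m" using L(1) by simp
    have "mexp (- L k) = (adj_mat (\<alpha> k) * \<alpha> k) * mexp (- L k)"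
      by (simp only: unitary_adj_mult[OF u] left_mult_one_mat[OF eL])
    also have "\<dots> = adj_mat (\<alpha> k) * (\<alpha> k * mexp (- L k))"
      by (rule assoc_mult_mat[OF adj_carrier[OF c] c eL])
    also have "\<dots> = adj_mat (\<alpha> k)" unfolding inv by (rule right_mult_one_mat[OF adj_carrier[OF c]])
    finally show "mexp (adj_mat (L k)) = mexp (- L k)"
      using mexp_adj[OF L(1)] L(3) by simp
  qed (use L in \<open>auto simp: mnorm_adj[OF L(1)] mnorm_uminus\<close>)
  define h where "h k = (- \<i>) \<cdot>\<^sub>m L k" for k
  have ih: "\<i> \<cdot>\<^sub>m h k = L k" for k unfolding h_def by (intro eq_matI) auto
  show thesis
  proof
    have "cont_mat m UNIV h" unfolding h_def L_def
      using L(1) c sm a by (intro cont_mat_smult cont_mat_mlog) (auto simp: L_def matching_family_def)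
    moreover have "Zperiodic h" 
      using a by (auto simp: h_def L_def matching_family_def Zperiodic_def)
    ultimately show "sym_family h"
      using L(1) flipL unfolding sym_family_def by (simp add: h_def flip_smult)
    show "mexp (\<i> \<cdot>\<^sub>m h k) = \<alpha> k" for k using L by (simp add: ih)
    have "adj_mat ((- \<i>) \<cdot>\<^sub>m L k) = \<i> \<cdot>\<^sub>m adj_mat (L k)" for k
      by (intro eq_matI) (auto simp: adj_mat_def)
    also have "\<i> \<cdot>\<^sub>m adj_mat (L k) = (- \<i>) \<cdot>\<^sub>m L k" for k
      unfolding adjL by (intro eq_matI) auto
    finally show "selfadj_m m (h k)" for k
      using L(1) by (simp add: selfadj_m_def h_def)
  qed
qed

section \<open>Multi-step logarithms from chains of close families\<close>

lemma msl_prod_cong: "(\<And>l. l \<in> {1..Suc n} \<Longrightarrow> h l = h' l) \<Longrightarrow> msl_prod h (Suc n) = msl_prod h' (Suc n)"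
proof (induction n)
  case (Suc n)
  then have "msl_prod h (Suc n) = msl_prod h' (Suc n)" by auto
  moreover have "h (Suc (Suc n)) = h' (Suc (Suc n))" using Suc.prems by auto
  ultimately show ?case by simp
qed simp

lemma multistep_log_iff:
  "multistep_log m \<epsilon> \<alpha> \<longleftrightarrow> (\<exists>M\<ge>1. \<exists>h. (\<forall>l\<in>{1..M}. sym_family (h l) \<and> (\<forall>k. selfadj_m m (h l k))) \<and>
     (\<forall>k. \<alpha> k = msl_prod (\<lambda>l. h l k) M))"
proof -
  have "((\<forall>k. selfadj_m m (h k)) \<and> cont_mat m UNIV h \<and> Zperiodic h \<and> (\<forall>k. \<epsilon> * h k = transpose_mat (h (- k)) * \<epsilon>))
     \<longleftrightarrow> sym_family h \<and> (\<forall>k. selfadj_m m (h k))" for h :: "'a \<Rightarrow> complex mat"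
    unfolding sym_family_def selfadj_m_def using sym_iff by metis
  then show ?thesis unfolding multistep_log_def by simp
qed

text \<open>The new exponential forms the outermost layer of the palindrome, so its exponent
  receives the largest index M + 1.\<close>

lemma multistep_log_extend:
  assumes a: "multistep_log m \<epsilon> \<alpha>" and h: "sym_family h" "\<And>k. selfadj_m m (h k)"
    and b: "\<And>k. \<beta> k = mexp ((\<i>/2) \<cdot>\<^sub>m h k) * \<alpha> k * mexp ((\<i>/2) \<cdot>\<^sub>m h k)"
  shows "multistep_log m \<epsilon> \<beta>"
proof -
  obtain M g where M: "M \<ge> 1" and g: "\<forall>l\<in>{1..M}. sym_family (g l) \<and> (\<forall>k. selfadj_m m (g l k))"
    and ag: "\<forall>k. \<alpha> k = msl_prod (\<lambda>l. g l k) M"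
    using a unfolding multistep_log_iff by blast
  obtain n where n: "M = Suc n" using M by (cases M) auto
  define g' where "g' = g(Suc M := h)"
  have "msl_prod (\<lambda>l. g' l k) M = \<alpha> k" for k
    using ag msl_prod_cong[of n "\<lambda>l. g' l k" "\<lambda>l. g l k"] by (auto simp: g'_def n)
  then have "\<forall>k. \<beta> k = msl_prod (\<lambda>l. g' l k) (Suc M)"
    by (simp add: b n g'_def)
  moreover have "\<forall>l\<in>{1..Suc M}. sym_family (g' l) \<and> (\<forall>k. selfadj_m m (g' l k))"
    using g h by (auto simp: g'_def)
  ultimately show ?thesis unfolding multistep_log_iff by (intro exI[of _ "Suc M"] conjI exI[of _ g']) auto
qed

text \<open>Quantifying over unitary factors makes closeness invariant under them, although \<open>mnorm\<close> is not.\<close>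
definition close :: "complex mat \<Rightarrow> complex mat \<Rightarrow> bool" where
  "close X Y \<longleftrightarrow> (\<forall>V W. unitary_m m V \<longrightarrow> unitary_m m W \<longrightarrow> mnorm (V * (X - Y) * W) \<le> mesh)"

text \<open>P X P - P Y P = P (X - Y) P, and the outer factors P are absorbed into the unitary
  matrices over which \<open>close\<close> quantifies.\<close>

lemma close_conj:
  assumes "close X Y" "unitary_m m P" "X \<in> carrier_mat m m" "Y \<in> carrier_mat m m"
  shows "close (P * X * P) (P * Y * P)"
  unfolding close_def
proof (intro allI impI)
  fix V W assume V: "unitary_m m V" and W: "unitary_m m W"
  note c = unitary_carrier[OF V] unitary_carrier[OF W] unitary_carrier[OF assms(2)] assms(3,4)
  have d: "X - Y \<in> carrier_mat m m" using c by simp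
  have "P * X * P - P * Y * P = P * (X - Y) * P"
    using c mult_minus_distrib_mat[OF c(3,4,5)] 
      minus_mult_distrib_mat[of "P * X" m m "P * Y" P m] by simp
  also have "V * (P * (X - Y) * P) * W = (V * P) * (X - Y) * (P * W)"
    using c d by (simp add: assoc_mult_mat[of _ m m _ m _ m])
  finally have "V * (P * X * P - P * Y * P) * W = (V * P) * (X - Y) * (P * W)" .
  then show "mnorm (V * (P * X * P - P * Y * P) * W) \<le> mesh"
    using assms V W by (simp add: close_def)
qed

text \<open>Since g 1 = W W with W = exp (i h / 2), multiplying by V = W^(-1) on both sides turns g
  1 into the identity. Restoring W at the end adds a layer, so the first step of the chain becomes
  the outermost one.\<close>

lemma multistep_log_chain:
  assumes "\<And>j. j \<le> n \<Longrightarrow> matching_family m \<epsilon> (g j)" "\<And>k. g 0 k = 1\<^sub>m m"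
    and "\<And>j k. j < n \<Longrightarrow> close (g (Suc j) k) (g j k)"
  shows "multistep_log m \<epsilon> (g n :: 'd::euclidean_space \<Rightarrow> complex mat)"
  using assms
proof (induction n arbitrary: g)
  case 0
  \<comment> \<open>A multi-step logarithm has at least one exponent, so the constant family 1 is
    written with the exponent 0.\<close>
  define h :: "nat \<Rightarrow> 'd \<Rightarrow> complex mat" where "h = (\<lambda>_ _. 0\<^sub>m m m)"
  have fz: "flip (0\<^sub>m m m) = 0\<^sub>m m m"
    by (simp add: flip_def right_mult_zero_mat[of _ m m] left_mult_zero_mat[of _ m m])
  have "sym_family (h l)" for l by (simp add: sym_family_def h_def Zperiodic_def fz)
  moreover have "selfadj_m m (h l k)" for l k
    by (auto simp: selfadj_m_def h_def adj_mat_def)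
  moreover have "g 0 k = msl_prod (\<lambda>l. h l k) (Suc 0)" for k using 0 by (simp add: h_def)
  ultimately show ?case unfolding multistep_log_iff 
    by (intro exI[of _ "Suc 0"] conjI exI[of _ h]) auto
next
  case (Suc n)
  have mf: "matching_family m \<epsilon> (g j)" if "j \<le> Suc n" for j using Suc.prems(1) that .
  have u: "unitary_m m (g j k)" if "j \<le> Suc n" for j k using mf[OF that] by (simp add: matching_family_iff)
  \<comment> \<open>Closeness to g 0 = 1, taken at the trivial unitary factors, is the bound that
    \<open>family_log\<close> asks for.\<close>
  have "mnorm (g 1 k - 1\<^sub>m m) \<le> mesh" for k
  proof -
    have "close (g (Suc 0) k) (1\<^sub>m m)" using Suc.prems(3)[of 0 k] Suc.prems(2) by simp
    then have "mnorm (1\<^sub>m m * (g (Suc 0) k - 1\<^sub>m m) * 1\<^sub>m m) \<le> mesh"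
      by (simp only: close_def unitary_one)
    moreover have c: "g (Suc 0) k - 1\<^sub>m m \<in> carrier_mat m m" by simp
    ultimately show ?thesis by (simp only: left_mult_one_mat[OF c] right_mult_one_mat[OF c] One_nat_def)
  qed
  then obtain h where h: "sym_family h" "\<And>k. selfadj_m m (h k)" "\<And>k. mexp (\<i> \<cdot>\<^sub>m h k) = g 1 k"
    using family_log[OF mf[of 1]] by auto
  have hc: "h k \<in> carrier_mat m m" for k using h(2) by (simp add: selfadj_m_def)
  define V where "V k = mexp ((- (\<i>/2)) \<cdot>\<^sub>m h k)" for k
  define W where "W k = mexp ((\<i>/2) \<cdot>\<^sub>m h k)" for k
  have c: "V k \<in> carrier_mat m m" "W k \<in> carrier_mat m m" for k using hc by (simp_all add: V_def W_def)
  have WV: "W k * V k = 1\<^sub>m m" "V k * W k = 1\<^sub>m m" for k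
    unfolding V_def W_def using mexp_smult_inverse[OF hc, of "\<i>/2" k] mexp_smult_inverse[OF hc, of "- (\<i>/2)" k] by auto
  have Vu: "unitary_m m (V k)" for k unfolding V_def using unitary_mexp(1)[OF h(2), of "- 1/2"] by simp
  \<comment> \<open>The index shift drops the old g 0: the new chain begins with the transformed g
    1.\<close>
  define g' where "g' j k = V k * g (Suc j) k * V k" for j k
  have "multistep_log m \<epsilon> (g' n)"
  proof (rule Suc.IH)
    fix j k assume j: "j < n"
    show "close (g' (Suc j) k) (g' j k)" unfolding g'_def
      using Suc.prems(3)[of "Suc j" k] u[of "Suc j" k] u[of "Suc (Suc j)" k] Vu j by (intro close_conj) auto
  next
    fix j assume "j \<le> n"
    then show "matching_family m \<epsilon> (g' j)"
      using mf[of "Suc j"] sym_family_conj[OF sym_family_mexp[OF h(1), of "- (\<i>/2)"], of "g (Suc j)"] Vu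
      unfolding matching_family_iff g'_def V_def by simp
  next
    fix k
    have "g 1 k = W k * W k" using mexp_add_smult[OF hc, of "\<i>/2" k "\<i>/2"] h(3) by (simp add: W_def)
    then have "g' 0 k = V k * (W k * W k) * V k" by (simp add: g'_def)
    also have "V k * (W k * W k) = (V k * W k) * W k"
      by (rule assoc_mult_mat[OF c(1) c(2) c(2), symmetric])
    also have "(V k * W k) * W k = W k" unfolding WV by (rule left_mult_one_mat[OF c(2)])
    finally show "g' 0 k = 1\<^sub>m m" unfolding WV .
  qed
  then show ?case
  proof (rule multistep_log_extend[OF _ h(1,2)])
    fix k
    have gc: "g (Suc n) k \<in> carrier_mat m m" using u by simp
    have "W k * g' n k * W k = W k * V k * (g (Suc n) k) * (V k * W k)"
      unfolding g'_def using gc c by (simp add: assoc_mult_mat[of _ m m _ m _ m])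
    also have "\<dots> = g (Suc n) k"
      unfolding WV left_mult_one_mat[OF gc] by (rule right_mult_one_mat[OF gc])
    finally show "g (Suc n) k = mexp ((\<i>/2) \<cdot>\<^sub>m h k) * g' n k * mexp ((\<i>/2) \<cdot>\<^sub>m h k)"
      unfolding W_def ..
  qed
qed

end

section \<open>From a null-homotopy to a multi-step logarithm\<close>

lemma unit_cube_translate:
  fixes k :: "'d::euclidean_space"
  obtains n where "\<forall>b\<in>Basis. inner n b \<in> \<int>" "k - n \<in> cbox 0 One"
proof
  let ?n = "\<Sum>b\<in>Basis. of_int \<lfloor>inner k b\<rfloor> *\<^sub>R b :: 'd"
  have n: "inner ?n b = of_int \<lfloor>inner k b\<rfloor>" if "b \<in> Basis" for b
    using that by simp
  show "\<forall>b\<in>Basis. inner ?n b \<in> \<int>" using n by simp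
  have "0 \<le> inner (k - ?n) b \<and> inner (k - ?n) b \<le> 1" if "b \<in> Basis" for b
    unfolding inner_diff_left n[OF that] by linarith
  then show "k - ?n \<in> cbox 0 One" by (simp add: mem_box)
qed

text \<open>Momentum space is not compact; uniformity in k comes from periodicity. An integer
  translation moves k into the unit cube, and on [0,1] times the cube each entry is uniformly
  continuous. The finitely many entries then share one N.\<close>

lemma homotopy_uniformly_continuous:
  fixes H :: "real \<Rightarrow> 'd::euclidean_space \<Rightarrow> complex mat"
  assumes c: "cont_mat m ({0..1} \<times> UNIV) (\<lambda>(t,k). H t k)"
    and p: "\<And>t. t \<in> {0..1} \<Longrightarrow> Zperiodic (H t)" and e: "e > 0"
  shows "\<exists>N. \<forall>n\<ge>N. \<forall>i<m. \<forall>j<m. \<forall>s\<in>{0..1}. \<forall>t\<in>{0..1}. \<bar>s - t\<bar> \<le> 1 / real (Suc n) \<longrightarrow>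
    (\<forall>k. cmod (H s k $$ (i,j) - H t k $$ (i,j)) < e)"
proof -
  have ev: "\<forall>\<^sub>F n in sequentially. \<forall>s\<in>{0..1}. \<forall>t\<in>{0..1}. \<bar>s - t\<bar> \<le> 1 / real (Suc n) \<longrightarrow>
    (\<forall>k. cmod (H s k $$ (i,j) - H t k $$ (i,j)) < e)" if ij: "i < m" "j < m" for i j
  proof -
    let ?K = "{0..1} \<times> (cbox 0 One :: 'd set)"
    let ?f = "\<lambda>x. (case x of (t,k) \<Rightarrow> H t k) $$ (i,j)"
    have "continuous_on ?K ?f"
      using c ij by (auto simp: cont_mat_def intro: continuous_on_subset)
    then have "uniformly_continuous_on ?K ?f"
      by (intro compact_uniformly_continuous compact_Times) auto
    then obtain d where d: "d > 0" and u: "\<And>x y. x \<in> ?K \<Longrightarrow> y \<in> ?K \<Longrightarrow> dist y x < d \<Longrightarrow> dist (?f y) (?f x) < e"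
      using e unfolding uniformly_continuous_on_def by meson
    have "(\<lambda>n. 1 / real (Suc n)) \<longlonglongrightarrow> 0" by (rule LIMSEQ_Suc[OF lim_1_over_n])
    then have "\<forall>\<^sub>F n in sequentially. 1 / real (Suc n) < d"
      using d by (rule order_tendstoD(2))
    then show ?thesis
    proof eventually_elim
      case (elim n)
      show ?case
      proof (intro ballI impI allI)
        fix s t :: real and k :: 'd
        assume s: "s \<in> {0..1}" and t: "t \<in> {0..1}" and st: "\<bar>s - t\<bar> \<le> 1 / real (Suc n)"
        obtain z where z: "\<forall>b\<in>Basis. inner z b \<in> \<int>" "k - z \<in> cbox 0 One"
          by (rule unit_cube_translate)
        have per: "H r k = H r (k - z)" if "r \<in> {0..1}" for r
        proof -
          have "H r ((k - z) + z) = H r (k - z)"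
            using p[OF that] z(1) unfolding Zperiodic_def by blast
          then show ?thesis by simp
        qed
        \<comment> \<open>The same translation z serves both times, so the two points differ only in
          time.\<close>
        have "dist (s, k - z) (t, k - z) < d"
          using elim st by (simp add: dist_Pair_Pair dist_real_def)
        then show "cmod (H s k $$ (i,j) - H t k $$ (i,j)) < e"
          using u[of "(t, k - z)" "(s, k - z)"] s t z(2) by (simp add: per dist_norm)
      qed
    qed
  qed
  have "\<forall>\<^sub>F n in sequentially. \<forall>i\<in>{..<m}. \<forall>j\<in>{..<m}. \<forall>s\<in>{0..1}. \<forall>t\<in>{0..1}. \<bar>s - t\<bar> \<le> 1 / real (Suc n) \<longrightarrow>
    (\<forall>k. cmod (H s k $$ (i,j) - H t k $$ (i,j)) < e)"
    using ev by (intro eventually_ball_finite[OF finite_lessThan] ballI) auto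
  then show ?thesis unfolding eventually_sequentially by (simp add: Ball_def)
qed

context time_reversal begin

lemma null_homotopic_imp_multistep_log:
  fixes \<alpha> :: "'d::euclidean_space \<Rightarrow> complex mat"
  assumes "equiv_null_homotopic m \<epsilon> \<alpha>"
  shows "multistep_log m \<epsilon> \<alpha>"
proof -
  obtain H :: "real \<Rightarrow> 'd \<Rightarrow> complex mat" where c: "cont_mat m ({0..1} \<times> UNIV) (\<lambda>(t,k). H t k)"
    and mf: "\<And>t. t \<in> {0..1} \<Longrightarrow> matching_family m \<epsilon> (H t)"
    and H0: "H 0 = \<alpha>" and H1: "H 1 = (\<lambda>k. 1\<^sub>m m)"
    using assms unfolding equiv_null_homotopic_def equiv_homotopic_def by blast
  \<comment> \<open>Entries within e give norm at most m^2 e, and two unitary factors multiply this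
    by at most m^4. Adding 1 prevents a division by 0.\<close>
  define e where "e = mesh / (real m ^ 4 * (real m * real m) + 1)"
  have pos: "real m ^ 4 * (real m * real m) + 1 > 0" by (intro add_nonneg_pos) auto
  have e: "e > 0" using mesh_pos pos by (simp add: e_def)
  have el: "real m ^ 4 * (real m * real m * e) \<le> mesh"
  proof -
    have "real m ^ 4 * (real m * real m * e) = real m ^ 4 * (real m * real m) * e" by simp
    also have "\<dots> \<le> (real m ^ 4 * (real m * real m) + 1) * e"
      using e by (intro mult_right_mono) auto
    also have "\<dots> = mesh" using pos unfolding e_def by simp
    finally show ?thesis .
  qed
  obtain n where n: "\<forall>i<m. \<forall>j<m. \<forall>s\<in>{0..1}. \<forall>t\<in>{0..1}. \<bar>s - t\<bar> \<le> 1 / real (Suc n) \<longrightarrow>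
    (\<forall>k. cmod (H s k $$ (i,j) - H t k $$ (i,j)) < e)"
    using homotopy_uniformly_continuous[OF c _ e] mf unfolding matching_family_def by blast
  \<comment> \<open>Time runs backwards: the homotopy starts at \<alpha>, whereas the chain has to
    start at the constant family 1.\<close>
  define T where "T j = 1 - real j / real (Suc n)" for j
  have T: "T j \<in> {0..1}" if "j \<le> Suc n" for j using that by (auto simp: T_def divide_le_eq)
  have "multistep_log m \<epsilon> (H (T (Suc n)))"
  proof (rule multistep_log_chain[where g = "\<lambda>j. H (T j)"])
    show "matching_family m \<epsilon> (H (T j))" if "j \<le> Suc n" for j using mf[OF T[OF that]] .
    show "H (T 0) k = 1\<^sub>m m" for k by (simp add: T_def H1)
    fix j k assume j: "j < Suc n"
    let ?X = "H (T (Suc j)) k" and ?Y = "H (T j) k"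
    have Tj: "T (Suc j) \<in> {0..1}" "T j \<in> {0..1}" using T j by auto
    have c: "?X \<in> carrier_mat m m" "?Y \<in> carrier_mat m m"
      using mf[OF Tj(1)] mf[OF Tj(2)] by (simp_all add: matching_family_iff)
    have "T (Suc j) - T j = - (1 / real (Suc n))" by (simp add: T_def diff_divide_distrib[symmetric] field_simps)
    then have "\<bar>T (Suc j) - T j\<bar> \<le> 1 / real (Suc n)" by simp
    then have "cmod ((?X - ?Y) $$ (a,b)) \<le> e" if "a < m" "b < m" for a b
      using n Tj that c by (auto intro: less_imp_le)
    then have d: "mnorm (?X - ?Y) \<le> real m * real m * e"
      using c by (intro mnorm_le_entries) auto
    show "close ?X ?Y" unfolding close_def
    proof (intro allI impI)
      fix V W assume "unitary_m m V" "unitary_m m W"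
      then have "mnorm (V * (?X - ?Y) * W) \<le> real m ^ 4 * mnorm (?X - ?Y)"
        using c by (intro mnorm_unitary_conj_le) auto
      also have "\<dots> \<le> real m ^ 4 * (real m * real m * e)"
        using d by (intro mult_left_mono) auto
      also note el
      finally show "mnorm (V * (?X - ?Y) * W) \<le> mesh" .
    qed
  qed
  then show ?thesis by (simp add: T_def H0)
qed

end

section \<open>From a multi-step logarithm to the extension in one more dimension\<close>

text \<open>This is b(t) at one momentum; the minus sign makes b(-1/2) the left half of the
  multi-step product.\<close>

primrec step_prod :: "nat \<Rightarrow> (nat \<Rightarrow> complex mat) \<Rightarrow> real \<Rightarrow> nat \<Rightarrow> complex mat" where
  "step_prod m h t 0 = 1\<^sub>m m"
| "step_prod m h t (Suc l) = mexp ((\<i> * of_real (- t)) \<cdot>\<^sub>m h (Suc l)) * step_prod m h t l"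

lemma step_prod_unitary:
  "(\<And>l. l \<in> {1..n} \<Longrightarrow> selfadj_m m (h l)) \<Longrightarrow> unitary_m m (step_prod m h t n)"
proof (induction n)
  case (Suc n)
  then show ?case unfolding step_prod.simps by (intro unitary_mult unitary_mexp(1) Suc.IH Suc.prems) auto
qed simp

text \<open>The adjoint reverses the factors of b(1/2) and changes the sign of their exponents. So
  the two halves mirror each other and meet at h 1, where exp (i h_1 / 2) occurs twice and gives exp
  (i h_1).\<close>

lemma step_prod_msl_prod:
  "(\<And>l. l \<in> {1..Suc n} \<Longrightarrow> selfadj_m m (h l)) \<Longrightarrow>
    step_prod m h (-1/2) (Suc n) * adj_mat (step_prod m h (1/2) (Suc n)) = msl_prod h (Suc n)"
proof (induction n)
  case 0
  then have h: "selfadj_m m (h 1)" by simp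
  then have c: "h 1 \<in> carrier_mat m m" by (simp add: selfadj_m_def)
  show ?case
    using adj_mexp_ii[OF h, of "-1/2"] mexp_add_smult[OF c, of "\<i>/2" "\<i>/2"] c
    by (simp add: adj_mult[of _ m] right_mult_one_mat[OF mexp_carrier])
next
  case (Suc n)
  let ?h = "h (Suc (Suc n))"
  have h: "selfadj_m m ?h" using Suc.prems by simp
  then have c: "?h \<in> carrier_mat m m" by (simp add: selfadj_m_def)
  define E where "E = mexp ((\<i>/2) \<cdot>\<^sub>m ?h)"
  define P where "P t = step_prod m h t (Suc n)" for t
  have Ec: "E \<in> carrier_mat m m" using c by (simp add: E_def)
  have Pc: "P t \<in> carrier_mat m m" "adj_mat (P t) \<in> carrier_mat m m" for t
    using step_prod_unitary[of "Suc n" m h t] Suc.prems by (auto simp: P_def simp del: step_prod.simps)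
  have a: "adj_mat (mexp ((\<i> * of_real (- 1/2)) \<cdot>\<^sub>m ?h)) = E"
    using adj_mexp_ii[OF h, of "-1/2"] by (simp add: E_def)
  have mc: "mexp ((\<i> * of_real (- 1/2)) \<cdot>\<^sub>m ?h) \<in> carrier_mat m m" using c by simp
  have "step_prod m h (-1/2) (Suc (Suc n)) = E * P (-1/2)" by (simp add: E_def P_def)
  moreover have "step_prod m h (1/2) (Suc (Suc n)) = mexp ((\<i> * of_real (- 1/2)) \<cdot>\<^sub>m ?h) * P (1/2)"
    by (simp add: P_def)
  moreover have "E * P (-1/2) * (adj_mat (P (1/2)) * E) = E * (P (-1/2) * adj_mat (P (1/2))) * E"
    using Ec Pc by (simp add: assoc_mult_mat[of _ m m _ m _ m])
  moreover have "P (-1/2) * adj_mat (P (1/2)) = msl_prod h (Suc n)"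
    using Suc unfolding P_def by auto
  ultimately show ?case
    by (simp only: adj_mult[OF mc Pc(1)] a) (simp add: E_def)
qed

lemma cont_mat_step_prod:
  fixes h :: "nat \<Rightarrow> 'd::euclidean_space \<Rightarrow> complex mat"
  assumes "\<And>l. l \<in> {1..n} \<Longrightarrow> cont_mat m UNIV (h l) \<and> (\<forall>k. selfadj_m m (h l k))"
  shows "cont_mat m UNIV (\<lambda>x. step_prod m (\<lambda>l. h l (snd x)) (fst x) n)"
  using assms
proof (induction n)
  case (Suc n)
  have h: "cont_mat m UNIV (h (Suc n))" "\<And>k. selfadj_m m (h (Suc n) k)" using Suc.prems by auto
  have hc: "h (Suc n) k \<in> carrier_mat m m" for k using h(2) by (simp add: selfadj_m_def)
  have c: "cont_mat m UNIV (\<lambda>x::real \<times> 'd. h (Suc n) (snd x))"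
    by (rule cont_mat_compose[OF h(1)]) (auto intro: continuous_intros)
  have e: "cont_mat m UNIV (\<lambda>x::real \<times> 'd. mexp ((\<i> * of_real (- fst x)) \<cdot>\<^sub>m h (Suc n) (snd x)))"
    by (intro cont_mat_mexp cont_mat_smult c continuous_intros) (use hc in auto)
  have u: "unitary_m m (step_prod m (\<lambda>l. h l k) t n)" for k t
    using Suc.prems by (intro step_prod_unitary) auto
  show ?case unfolding step_prod.simps
    using Suc.IH Suc.prems u hc by (intro cont_mat_mult e) auto
qed simp

lemma adj_pow:
  assumes A: "A \<in> carrier_mat m m"
  shows "adj_mat (A ^\<^sub>m n) = adj_mat A ^\<^sub>m n"
proof (induction n)
  case 0
  then show ?case using A carrier_matD[OF adj_carrier[OF A]] by simp
next
  case (Suc n)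
  have "A ^\<^sub>m Suc n = A * A ^\<^sub>m n" using pow_mat_add[OF A, of 1 n] A by simp
  then have "adj_mat (A ^\<^sub>m Suc n) = adj_mat (A ^\<^sub>m n) * adj_mat A"
    using adj_mult[OF A pow_carrier_mat[OF A]] by simp
  then show ?case by (simp add: Suc)
qed

text \<open>For a unitary matrix this is the integer power with exponent \<open>- n\<close>.\<close>
definition neg_pow :: "complex mat \<Rightarrow> int \<Rightarrow> complex mat" where
  "neg_pow A n = A ^\<^sub>m nat (- n) * adj_mat A ^\<^sub>m nat n"

lemma neg_pow_unitary [simp]: "unitary_m m A \<Longrightarrow> unitary_m m (neg_pow A n)"
  unfolding neg_pow_def by (intro unitary_mult unitary_pow unitary_adj)

text \<open>Both sides are needed: the factor on the right meets b(-1/2) when neighbouring cells are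
  glued, the factor on the left produces \<alpha> in condition (d).\<close>

lemma neg_pow_add_one:
  assumes A: "unitary_m m A"
  shows "neg_pow A (n + 1) = adj_mat A * neg_pow A n" "neg_pow A (n + 1) = neg_pow A n * adj_mat A"
proof -
  note Ac = unitary_carrier[OF A] and Bc = adj_carrier[OF unitary_carrier[OF A]]
  have pl: "X ^\<^sub>m Suc p = X * X ^\<^sub>m p" if "X \<in> carrier_mat m m" for X :: "complex mat" and p
    using pow_mat_add[OF that, of 1 p] that by simp
  have one: "X ^\<^sub>m 0 = 1\<^sub>m m" if "X \<in> carrier_mat m m" for X :: "complex mat" using that by simp
  \<comment> \<open>\<open>nat\<close> truncates at 0, so for each sign of n at most one power in
    \<open>neg_pow\<close> is nontrivial. The value n = -1 belongs to the second case, with p =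
    0.\<close>
  consider p where "n = int p" | p where "n = - int (Suc p)"
    by (metis int_cases)
  then have "neg_pow A (n + 1) = adj_mat A * neg_pow A n \<and> neg_pow A (n + 1) = neg_pow A n * adj_mat A"
  proof cases
    case 1
    then have "nat n = p" "nat (n + 1) = Suc p" "nat (- n) = 0" "nat (- (n + 1)) = 0" by auto
    note e = this
    have "neg_pow A n = adj_mat A ^\<^sub>m p" "neg_pow A (n + 1) = adj_mat A ^\<^sub>m Suc p"
      unfolding neg_pow_def e one[OF Ac]
      by (rule left_mult_one_mat[OF pow_carrier_mat[OF Bc]])+
    then show ?thesis using pl[OF Bc] by simp
  next
    case 2
    then have "nat n = 0" "nat (n + 1) = 0" "nat (- n) = Suc p" "nat (- (n + 1)) = p" by auto
    note e = this
    have e': "neg_pow A n = A ^\<^sub>m Suc p" "neg_pow A (n + 1) = A ^\<^sub>m p"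
      unfolding neg_pow_def e one[OF Bc]
      by (rule right_mult_one_mat[OF pow_carrier_mat[OF Ac]])+
    note P = pow_carrier_mat[OF Ac, of p]
    have "adj_mat A * A ^\<^sub>m Suc p = (adj_mat A * A) * A ^\<^sub>m p"
      unfolding pl[OF Ac] by (rule assoc_mult_mat[OF Bc Ac P, symmetric])
    also have "\<dots> = A ^\<^sub>m p" unfolding unitary_adj_mult[OF A] by (rule left_mult_one_mat[OF P])
    finally have l: "adj_mat A * A ^\<^sub>m Suc p = A ^\<^sub>m p" .
    have "A ^\<^sub>m Suc p * adj_mat A = A ^\<^sub>m p * (A * adj_mat A)"
      unfolding pow_mat.simps by (rule assoc_mult_mat[OF P Ac Bc])
    also have "\<dots> = A ^\<^sub>m p" unfolding unitary_mult_adj[OF A] by (rule right_mult_one_mat[OF P])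
    finally show ?thesis using l e' by simp
  qed
  then show "neg_pow A (n + 1) = adj_mat A * neg_pow A n" "neg_pow A (n + 1) = neg_pow A n * adj_mat A" by auto
qed

lemma the_mat_inverse_eqI:
  fixes A :: "'a::field mat"
  assumes A: "A \<in> carrier_mat m m" and B: "B \<in> carrier_mat m m" and AB: "A * B = 1\<^sub>m m" and BA: "B * A = 1\<^sub>m m"
  shows "the (mat_inverse A) = B"
proof (cases "mat_inverse A")
  case None
  have "A \<in> Units (ring_mat TYPE('a) m ())"
    using A B AB BA by (auto simp: Units_def ring_mat_def)
  then show ?thesis using mat_inverse(1)[OF A None, of "()"] by blast
next
  case (Some C)
  then have C: "A * C = 1\<^sub>m m" "C \<in> carrier_mat m m" using mat_inverse(2)[OF A] by auto
  have "C = (B * A) * C" using BA C by simp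
  also have "\<dots> = B * (A * C)" by (rule assoc_mult_mat[OF B A C(2)])
  also have "\<dots> = B" unfolding C(1) by (rule right_mult_one_mat[OF B])
  finally show ?thesis using Some by simp
qed

context time_reversal begin

lemma the_mat_inverse_eps: "the (mat_inverse \<epsilon>) = transpose_mat \<epsilon>"
  by (rule the_mat_inverse_eqI[where m = m]) simp_all

lemma the_mat_inverse_unitary: "unitary_m m U \<Longrightarrow> the (mat_inverse U) = adj_mat U"
  by (rule the_mat_inverse_eqI[where m = m]) simp_all

lemma beta_cond_iff:
  "beta_cond m \<epsilon> \<alpha> \<beta> \<longleftrightarrow>
     (\<forall>x. unitary_m m (\<beta> x)) \<and> cont_mat m UNIV \<beta> \<and> (\<forall>k1. Zperiodic (\<lambda>k. \<beta> (k1, k))) \<and>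
     (\<forall>k1 k. \<beta> (- k1, - k) = flip (adj_mat (\<beta> (k1, k)))) \<and>
     (\<forall>k1 k. \<alpha> k = \<beta> (k1, k) * adj_mat (\<beta> (k1 + 1, k)))"
  unfolding beta_cond_def the_mat_inverse_eps flip_adj_eq
  using the_mat_inverse_unitary by auto

lemma flip_adj_mult:
  assumes "X \<in> carrier_mat m m" "Y \<in> carrier_mat m m"
  shows "flip (adj_mat (X * Y)) = flip (adj_mat X) * flip (adj_mat Y)"
  using assms by (simp add: adj_mult[of _ m] flip_mult)

text \<open>In each factor the adjoint changes the sign of t, and \<open>flip\<close> replaces h(k)
  by h(-k). The order of the factors is kept because it is reversed twice.\<close>

lemma step_prod_flip:
  assumes "\<And>l. l \<in> {1..n} \<Longrightarrow> sym_family (h l) \<and> (\<forall>k. selfadj_m m (h l k))"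
  shows "step_prod m (\<lambda>l. h l (- k)) (- t) n = flip (adj_mat (step_prod m (\<lambda>l. h l k) t n))"
  using assms
proof (induction n)
  case (Suc n)
  have h: "sym_family (h (Suc n))" "\<And>k. selfadj_m m (h (Suc n) k)" using Suc.prems by auto
  note hc = sym_familyD(1)[OF h(1)]
  have u: "unitary_m m (step_prod m (\<lambda>l. h l k) t n)"
    using Suc.prems by (intro step_prod_unitary) auto
  have "flip (h (Suc n) k) = h (Suc n) (- k)" using sym_familyD(4)[OF h(1), of "- k"] by simp
  then have "flip (adj_mat (mexp ((\<i> * of_real (- t)) \<cdot>\<^sub>m h (Suc n) k))) = mexp ((\<i> * of_real (- (- t))) \<cdot>\<^sub>m h (Suc n) (- k))"
    unfolding adj_mexp_ii[OF h(2)] using hc by (simp add: mexp_flip[symmetric] flip_smult)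
  moreover have "step_prod m (\<lambda>l. h l (- k)) (- t) n = flip (adj_mat (step_prod m (\<lambda>l. h l k) t n))"
    using Suc by auto
  ultimately show ?case
    unfolding step_prod.simps using flip_adj_mult[OF mexp_carrier[OF smult_carrier_mat[OF hc]] unitary_carrier[OF u]] by simp
qed simp

text \<open>For unitary A the adjoint is the inverse, so the exponent changes sign, while
  \<open>flip\<close> passes to the base.\<close>

lemma flip_adj_neg_pow:
  assumes A: "unitary_m m A"
  shows "flip (adj_mat (neg_pow A n)) = neg_pow (flip A) (- n)"
proof -
  note Ac = unitary_carrier[OF A] and Bc = adj_carrier[OF unitary_carrier[OF A]]
  note fA = flip_carrier[OF Ac] and fB = flip_carrier[OF Bc]
  have "flip (adj_mat (neg_pow A n)) = flip (adj_mat A) ^\<^sub>m nat (- n) * flip A ^\<^sub>m nat n"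
    unfolding neg_pow_def using Ac Bc
    by (simp add: flip_adj_mult pow_carrier_mat adj_pow[of _ m] flip_pow)
  also have "flip (adj_mat A) = adj_mat (flip A)" by (simp add: adj_flip[OF Ac])
  \<comment> \<open>The two powers may be exchanged because one of the exponents is 0.\<close>
  also have "adj_mat (flip A) ^\<^sub>m nat (- n) * flip A ^\<^sub>m nat n = flip A ^\<^sub>m nat n * adj_mat (flip A) ^\<^sub>m nat (- n)"
  proof (cases "n \<ge> 0")
    case True
    then have "nat (- n) = 0" by simp
    then show ?thesis 
      using left_mult_one_mat[OF pow_carrier_mat[OF fA]] right_mult_one_mat[OF pow_carrier_mat[OF fA]] 
        carrier_matD[OF adj_carrier[OF fA]] by simp
  next
    case False
    then have "nat n = 0" by simp
    then show ?thesis 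
      using left_mult_one_mat[OF pow_carrier_mat[OF adj_carrier[OF fA]]] right_mult_one_mat[OF pow_carrier_mat[OF adj_carrier[OF fA]]] 
        carrier_matD[OF fA] by simp
  qed
  finally show ?thesis by (simp add: neg_pow_def)
qed

text \<open>The last hypothesis amounts to b(1/2) = \<alpha>^(-1) b(-1/2), hence \<alpha>^(-n)
  b(1/2) = \<alpha>^(-n-1) b(-1/2): the formulas of neighbouring cells agree at the half-integer
  between them.\<close>

lemma beta_extension:
  fixes b :: "real \<Rightarrow> 'd::euclidean_space \<Rightarrow> complex mat"
  assumes a: "matching_family m \<epsilon> \<alpha>" and u: "\<And>t k. unitary_m m (b t k)"
    and c: "cont_mat m UNIV (\<lambda>x. b (fst x) (snd x))" and p: "\<And>t. Zperiodic (b t)"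
    and f: "\<And>t k. b (- t) (- k) = flip (adj_mat (b t k))"
    and ab: "\<And>k. \<alpha> k = b (-1/2) k * adj_mat (b (1/2) k)"
  shows "\<exists>\<beta>. beta_cond m \<epsilon> \<alpha> \<beta>"
proof -
  have au: "unitary_m m (\<alpha> k)" for k using a by (simp add: matching_family_iff)
  have sa: "sym_family \<alpha>" using a by (simp add: matching_family_iff)
  define \<beta> where "\<beta> = (\<lambda>(x, k). neg_pow (\<alpha> k) \<lfloor>x + 1/2\<rfloor> * b (x - of_int \<lfloor>x + 1/2\<rfloor>) k)"
  \<comment> \<open>The formula is valid on the closed cell, including t = 1/2, where the floor
    already jumps to n + 1. Closed cells are invariant under t -> -t, as the symmetry requires, and
    can be glued continuously.\<close>
  have rep: "\<beta> (of_int n + t, k) = neg_pow (\<alpha> k) n * b t k" if t: "-1/2 \<le> t" "t \<le> 1/2" for n t k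
  proof (cases "t = 1/2")
    case False
    then have "\<lfloor>of_int n + t + 1/2\<rfloor> = n" using t by (intro floor_unique) auto
    then show ?thesis by (simp add: \<beta>_def)
  next
    case True
    note cc = unitary_carrier[OF neg_pow_unitary[OF au, of k n]] adj_carrier[OF unitary_carrier[OF au[of k]]]
      unitary_carrier[OF u[of "-1/2" k]] unitary_carrier[OF u[of "1/2" k]]
    have fl: "\<lfloor>of_int n + t + 1/2\<rfloor> = n + 1" using True by (intro floor_unique) auto
    have "adj_mat (\<alpha> k) * b (-1/2) k = b (1/2) k"
    proof -
      have "adj_mat (\<alpha> k) = b (1/2) k * adj_mat (b (-1/2) k)"
        unfolding ab[of k] adj_mult[OF cc(3) adj_carrier[OF cc(4)]] by simp
      then have "adj_mat (\<alpha> k) * b (-1/2) k = b (1/2) k * (adj_mat (b (-1/2) k) * b (-1/2) k)"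
        using assoc_mult_mat[OF cc(4) adj_carrier[OF cc(3)] cc(3)] by simp
      then show ?thesis unfolding unitary_adj_mult[OF u] using right_mult_one_mat[OF cc(4)] by simp
    qed
    moreover have "neg_pow (\<alpha> k) n * adj_mat (\<alpha> k) * b (-1/2) k = neg_pow (\<alpha> k) n * (adj_mat (\<alpha> k) * b (-1/2) k)"
      by (rule assoc_mult_mat[OF cc(1-3)])
    ultimately have "neg_pow (\<alpha> k) (n + 1) * b (-1/2) k = neg_pow (\<alpha> k) n * b (1/2) k"
      by (simp only: neg_pow_add_one(2)[OF au])
    moreover have "\<beta> (of_int n + t, k) = neg_pow (\<alpha> k) (n + 1) * b (-1/2) k"
    proof -
      have "of_int n + t - of_int (n + 1) = -1/2" using True by simp
      then show ?thesis unfolding \<beta>_def case_prod_conv fl by (simp only:)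
    qed
    ultimately show ?thesis by (simp only: True)
  qed
  have decomp: "\<exists>n t. x = of_int n + t \<and> -1/2 \<le> t \<and> t \<le> 1/2" for x :: real
    by (rule exI[of _ "\<lfloor>x + 1/2\<rfloor>"], rule exI[of _ "x - of_int \<lfloor>x + 1/2\<rfloor>"]) (auto, linarith+)
  have "unitary_m m (\<beta> x)" for x by (cases x) (auto simp: \<beta>_def u au)
  moreover have "cont_mat m UNIV \<beta>"
  proof -
    have cell: "cont_mat m ({of_int n - 1/2..of_int n + 1/2} \<times> UNIV) \<beta>" for n
    proof -
      have ca: "cont_mat m UNIV (\<lambda>x::real \<times> 'd. \<alpha> (snd x))"
        by (rule cont_mat_compose[OF sym_familyD(2)[OF sa]]) (auto intro: continuous_intros)
      have cb: "cont_mat m UNIV (\<lambda>x::real \<times> 'd. b (fst x - of_int n) (snd x))"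
        using cont_mat_compose[OF c, of UNIV "\<lambda>x. (fst x - of_int n, snd x)"] by (simp add: continuous_intros)
      have "cont_mat m UNIV (\<lambda>x::real \<times> 'd. neg_pow (\<alpha> (snd x)) n * b (fst x - of_int n) (snd x))"
        unfolding neg_pow_def using unitary_carrier[OF au] unitary_carrier[OF u]
        by (intro cont_mat_mult cont_mat_pow cont_mat_adj ca cb mult_carrier_square pow_carrier_mat adj_carrier) auto
      then have "continuous_on ({of_int n - 1/2..of_int n + 1/2} \<times> UNIV)
        (\<lambda>x::real \<times> 'd. (neg_pow (\<alpha> (snd x)) n * b (fst x - of_int n) (snd x)) $$ (i,j))" if "i < m" "j < m" for i j
        using that unfolding cont_mat_def by (meson continuous_on_subset subset_UNIV)
      moreover have "\<beta> x = neg_pow (\<alpha> (snd x)) n * b (fst x - of_int n) (snd x)"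
        if "x \<in> {of_int n - 1/2..of_int n + 1/2} \<times> UNIV" for x
        using rep[of "fst x - of_int n" n "snd x"] that by auto
      ultimately show ?thesis unfolding cont_mat_def by (simp cong: continuous_on_cong)
    qed
    show ?thesis unfolding cont_mat_def
    proof (intro allI impI)
      fix i j assume ij: "i < m" "j < m"
      \<comment> \<open>Two neighbouring closed slabs contain an open slab around their common face.
        Such open slabs cover the whole space, so continuity on each of them suffices.\<close>
      have open_part: "continuous_on ({of_int n - 1/2<..<of_int n + 3/2} \<times> UNIV) (\<lambda>x. \<beta> x $$ (i,j))" for n
      proof (rule continuous_on_subset)
        show "continuous_on ({of_int n - 1/2..of_int n + 1/2} \<times> UNIV \<union> {of_int (n+1) - 1/2..of_int (n+1) + 1/2} \<times> UNIV) (\<lambda>x. \<beta> x $$ (i,j))"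
          using cell[of n] cell[of "n+1"] ij by (intro continuous_on_closed_Un closed_Times) (auto simp: cont_mat_def)
      qed auto
      have "continuous_on (\<Union>n. {of_int n - 1/2<..<of_int n + 3/2} \<times> UNIV) (\<lambda>x. \<beta> x $$ (i,j))"
        by (intro continuous_on_open_UN open_Times open_part) auto
      moreover have "(\<Union>n. {of_int n - 1/2<..<of_int n + 3/2} \<times> UNIV) = (UNIV :: (real \<times> 'd) set)"
      proof (intro equalityI subsetI UNIV_I)
        fix x :: "real \<times> 'd"
        have "fst x \<in> {of_int \<lfloor>fst x\<rfloor> - 1/2<..<of_int \<lfloor>fst x\<rfloor> + 3/2}" 
          unfolding greaterThanLessThan_iff by linarith
        then show "x \<in> (\<Union>n. {of_int n - 1/2<..<of_int n + 3/2} \<times> UNIV)" 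
          by (cases x) auto
      qed
      ultimately show "continuous_on UNIV (\<lambda>x. \<beta> x $$ (i,j))" by simp
    qed
  qed
  moreover have "Zperiodic (\<lambda>k. \<beta> (k1, k))" for k1
    using p sym_familyD(3)[OF sa] by (simp add: \<beta>_def Zperiodic_def)
  moreover have "\<beta> (- x, - k) = flip (adj_mat (\<beta> (x, k)))" for x k
  proof -
    obtain n t where x: "x = of_int n + t" "-1/2 \<le> t" "t \<le> 1/2" using decomp by blast
    \<comment> \<open>-t lies in the closed cell even when t is an endpoint, so \<open>rep\<close>
      applies to this decomposition.\<close>
    have mx: "- x = of_int (- n) + (- t)" using x by simp
    have fa: "flip (\<alpha> k) = \<alpha> (- k)" using sym_familyD(4)[OF sa, of "- k"] by simp
    have "\<beta> (- x, - k) = neg_pow (\<alpha> (- k)) (- n) * b (- t) (- k)"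
      unfolding mx using x by (intro rep) auto
    also have "\<dots> = flip (adj_mat (neg_pow (\<alpha> k) n)) * flip (adj_mat (b t k))"
      by (simp add: flip_adj_neg_pow[OF au] fa f)
    also have "\<dots> = flip (adj_mat (\<beta> (x, k)))"
      unfolding x(1) rep[OF x(2,3)]
      by (intro flip_adj_mult[symmetric] unitary_carrier neg_pow_unitary au u)
    finally show ?thesis .
  qed
  moreover have "\<alpha> k = \<beta> (x, k) * adj_mat (\<beta> (x + 1, k))" for x k
  proof -
    obtain n t where x: "x = of_int n + t" "-1/2 \<le> t" "t \<le> 1/2" using decomp by blast
    \<comment> \<open>Adding 1 changes n but not t, so \<beta> gains exactly one factor
      \<alpha>^(-1) on the left.\<close>
    have x1: "x + 1 = of_int (n + 1) + t" using x by simp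
    define P where "P = \<beta> (x, k)"
    have P: "P = neg_pow (\<alpha> k) n * b t k" unfolding P_def x(1) using x by (intro rep)
    then have Pu: "unitary_m m P" using u au by simp
    note cc = unitary_carrier[OF au[of k]] unitary_carrier[OF Pu] adj_carrier[OF unitary_carrier[OF Pu]]
    have "\<beta> (x + 1, k) = neg_pow (\<alpha> k) (n + 1) * b t k" unfolding x1 using x by (intro rep)
    also have "\<dots> = adj_mat (\<alpha> k) * P"
      unfolding neg_pow_add_one(1)[OF au] P
      by (intro assoc_mult_mat[where n\<^sub>1 = m and n\<^sub>2 = m and n\<^sub>3 = m and n\<^sub>4 = m] unitary_carrier neg_pow_unitary au u unitary_adj)
    finally have "adj_mat (\<beta> (x + 1, k)) = adj_mat P * \<alpha> k"
      using adj_mult[OF adj_carrier[OF cc(1)] cc(2)] by simp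
    then have "\<beta> (x, k) * adj_mat (\<beta> (x + 1, k)) = (P * adj_mat P) * \<alpha> k"
      using assoc_mult_mat[OF cc(2,3,1)] by (simp add: P_def)
    then show ?thesis unfolding unitary_mult_adj[OF Pu] using left_mult_one_mat[OF cc(1)] by simp
  qed
  ultimately have "beta_cond m \<epsilon> \<alpha> \<beta>" unfolding beta_cond_iff by blast
  then show ?thesis by blast
qed

lemma multistep_log_imp_beta:
  fixes \<alpha> :: "'d::euclidean_space \<Rightarrow> complex mat"
  assumes a: "matching_family m \<epsilon> \<alpha>" and l: "multistep_log m \<epsilon> \<alpha>"
  shows "\<exists>\<beta>. beta_cond m \<epsilon> \<alpha> \<beta>"
proof -
  obtain M and h :: "nat \<Rightarrow> 'd \<Rightarrow> complex mat" where M: "M \<ge> 1"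
    and h: "\<And>l. l \<in> {1..M} \<Longrightarrow> sym_family (h l) \<and> (\<forall>k. selfadj_m m (h l k))"
    and ah: "\<And>k. \<alpha> k = msl_prod (\<lambda>l. h l k) M"
    using l unfolding multistep_log_iff by blast
  obtain n where n: "M = Suc n" using M by (cases M) auto
  show ?thesis
  proof (rule beta_extension[OF a, where b = "\<lambda>t k. step_prod m (\<lambda>l. h l k) t M"])
    show "unitary_m m (step_prod m (\<lambda>l. h l k) t M)" for t k
      using h by (intro step_prod_unitary) auto
    show "cont_mat m UNIV (\<lambda>x. step_prod m (\<lambda>l. h l (snd x)) (fst x) M)"
      using h sym_familyD(2) by (intro cont_mat_step_prod) auto
    have "step_prod m (\<lambda>l. h l (k + z)) t j = step_prod m (\<lambda>l. h l k) t j"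
      if "\<forall>b\<in>Basis. inner z b \<in> \<int>" "j \<le> M" for z k t j
      using that(2)
    proof (induction j)
      case (Suc j)
      then have "Zperiodic (h (Suc j))" using h sym_familyD(3) by auto
      then have "h (Suc j) (k + z) = h (Suc j) k" using that(1) by (simp add: Zperiodic_def)
      then show ?case using Suc by simp
    qed simp
    then show "Zperiodic (\<lambda>k. step_prod m (\<lambda>l. h l k) t M)" for t by (simp add: Zperiodic_def)
    show "step_prod m (\<lambda>l. h l (- k)) (- t) M = flip (adj_mat (step_prod m (\<lambda>l. h l k) t M))" for t k
      using h by (rule step_prod_flip)
    show "\<alpha> k = step_prod m (\<lambda>l. h l k) (- 1 / 2) M * adj_mat (step_prod m (\<lambda>l. h l k) (1 / 2) M)" for k
      using step_prod_msl_prod[of n m "\<lambda>l. h l k"] h unfolding n ah by auto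
  qed
qed

section \<open>From the extension back to a null-homotopy\<close>

text \<open>By (c), \<open>flip\<close> sends \<beta>(-r,-k) to the adjoint of \<beta>(r,k), and the
  adjoint of \<beta>(r,-k) to \<beta>(-r,k). As it also reverses products, \<beta>(-r,k)
  \<beta>(r,k)^(-1) is a symmetric family for every r.\<close>

lemma beta_imp_null_homotopic:
  fixes \<alpha> :: "'d::euclidean_space \<Rightarrow> complex mat"
  assumes "beta_cond m \<epsilon> \<alpha> \<beta>"
  shows "equiv_null_homotopic m \<epsilon> \<alpha>"
proof -
  have u: "\<And>x. unitary_m m (\<beta> x)" and c: "cont_mat m UNIV \<beta>" and p: "\<And>k1. Zperiodic (\<lambda>k. \<beta> (k1, k))"
    and f: "\<And>k1 k. \<beta> (- k1, - k) = flip (adj_mat (\<beta> (k1, k)))"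
    and ab: "\<And>k1 k. \<alpha> k = \<beta> (k1, k) * adj_mat (\<beta> (k1 + 1, k))"
    using assms unfolding beta_cond_iff by blast+
  note uc = unitary_carrier[OF u]
  \<comment> \<open>With r = (1 - t) / 2 the path starts at \<alpha>, by (d) at k_1 = -1/2, and ends
    at 1, the direction that \<open>equiv_null_homotopic\<close> prescribes.\<close>
  define H where "H t k = \<beta> (- ((1 - t) / 2), k) * adj_mat (\<beta> ((1 - t) / 2, k))" for t k
  have cH: "cont_mat m UNIV (\<lambda>x. H (fst x) (snd x))"
    unfolding H_def
    by (intro cont_mat_mult cont_mat_adj cont_mat_compose[OF c] continuous_intros uc adj_carrier) auto
  have "matching_family m \<epsilon> (H t)" for t
    unfolding matching_family_iff
  proof (intro conjI allI sym_familyI)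
    show Hu: "unitary_m m (H t k)" for k unfolding H_def by (intro unitary_mult unitary_adj u)
    then show "H t k \<in> carrier_mat m m" for k by simp
    show "cont_mat m UNIV (H t)"
      using cont_mat_compose[OF cH, of UNIV "\<lambda>k. (t, k)"] by (simp add: continuous_intros)
    show "Zperiodic (H t)" using p by (simp add: H_def Zperiodic_def)
    fix k
    let ?r = "(1 - t) / 2"
    have "flip (H t (- k)) = flip (adj_mat (\<beta> (?r, - k))) * flip (\<beta> (- ?r, - k))"
      unfolding H_def by (rule flip_mult[OF uc adj_carrier[OF uc]])
    also have "flip (adj_mat (\<beta> (?r, - k))) = \<beta> (- ?r, k)" using f[of ?r "- k"] by simp
    also have "flip (\<beta> (- ?r, - k)) = adj_mat (\<beta> (?r, k))"
      unfolding f by (rule flip_flip[OF adj_carrier[OF uc]])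
    finally show "flip (H t (- k)) = H t k" by (simp add: H_def)
  qed
  moreover have "cont_mat m ({0..1} \<times> UNIV) (\<lambda>(t,k). H t k)"
    using cont_mat_compose[OF cH, of "{0..1} \<times> UNIV" "\<lambda>x. x"] by (simp add: split_def)
  moreover have "H 0 = \<alpha>" using ab[of _ "-1/2"] by (simp add: H_def fun_eq_iff)
  moreover have "H 1 = (\<lambda>k. 1\<^sub>m m)" using u by (simp add: H_def fun_eq_iff)
  ultimately show ?thesis unfolding equiv_null_homotopic_def equiv_homotopic_def by blast
qed

end

section \<open>The two admissible matrices and the equivalence\<close>

text \<open>J is a signed permutation matrix: row i has its only nonzero entry, the sign
  \<open>g i\<close>, in column \<open>\<sigma> i\<close>. Orthogonality thus reduces to the
  injectivity of \<sigma>.\<close>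

lemma Jsymp_mult_transpose:
  assumes "even m"
  shows "Jsymp m * transpose_mat (Jsymp m) = 1\<^sub>m m"
proof (intro eq_matI)
  define \<sigma> where "\<sigma> i = (if i < m div 2 then i + m div 2 else i - m div 2)" for i
  define g where "g i = (if i < m div 2 then 1 else - 1 :: complex)" for i
  have J: "Jsymp m $$ (i,k) = (if k = \<sigma> i then g i else 0)" if "i < m" "k < m" for i k
    using that assms by (auto simp: Jsymp_def \<sigma>_def g_def)
  have Jc: "Jsymp m \<in> carrier_mat m m" by (simp add: Jsymp_def)
  fix i j assume "i < dim_row (1\<^sub>m m :: complex mat)" "j < dim_col (1\<^sub>m m :: complex mat)"
  then have ij: "i < m" "j < m" by auto
  have s: "\<sigma> i < m" using ij assms by (auto simp: \<sigma>_def elim!: evenE)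
  have inj: "\<sigma> i = \<sigma> j \<longleftrightarrow> i = j" using ij assms by (auto simp: \<sigma>_def elim!: evenE)
  have "(Jsymp m * transpose_mat (Jsymp m)) $$ (i,j) = (\<Sum>k<m. Jsymp m $$ (i,k) * Jsymp m $$ (j,k))"
    using Jc ij by (subst index_mult_mat_sum[of _ m]) auto
  also have "\<dots> = (\<Sum>k<m. if k = \<sigma> i then g i * (if \<sigma> i = \<sigma> j then g j else 0) else 0)"
    using ij by (intro sum.cong) (auto simp: J)
  also have "\<dots> = (if i = j then 1 else 0)"
    using s by (simp add: inj) (simp add: g_def)
  finally show "(Jsymp m * transpose_mat (Jsymp m)) $$ (i,j) = 1\<^sub>m m $$ (i,j)" using ij by simp
qed (simp_all add: Jsymp_def)

lemma eps_ok_time_reversal: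
  assumes "eps_ok m \<epsilon>"
  shows "\<exists>s. time_reversal m \<epsilon> s"
proof (cases "\<epsilon> = 1\<^sub>m m")
  case True
  have "time_reversal m \<epsilon> 1"
    unfolding True by unfold_locales (auto intro!: eq_matI)
  then show ?thesis ..
next
  case False
  then have e: "even m" "\<epsilon> = Jsymp m" using assms by (auto simp: eps_ok_def)
  have "time_reversal m \<epsilon> (- 1)"
  proof
    show "transpose_mat \<epsilon> = - 1 \<cdot>\<^sub>m \<epsilon>" unfolding e Jsymp_def using e(1) by (intro eq_matI) (auto elim!: evenE)
    show "map_mat cnj \<epsilon> = \<epsilon>" unfolding e Jsymp_def by (intro eq_matI) auto
    show "\<epsilon> * transpose_mat \<epsilon> = 1\<^sub>m m" unfolding e(2) by (rule Jsymp_mult_transpose[OF e(1)])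
  qed (simp_all add: e Jsymp_def)
  then show ?thesis ..
qed

theorem theorem2p4:
  fixes m :: nat and \<epsilon> :: "complex mat" and \<alpha> :: "'d::euclidean_space \<Rightarrow> complex mat"
  assumes "m \<ge> 1"
    and "eps_ok m \<epsilon>"
    and "matching_family m \<epsilon> \<alpha>"
  shows "(equiv_null_homotopic m \<epsilon> \<alpha> \<longleftrightarrow> multistep_log m \<epsilon> \<alpha>) \<and>
         (multistep_log m \<epsilon> \<alpha> \<longleftrightarrow> (\<exists>\<beta>. beta_cond m \<epsilon> \<alpha> \<beta>))"
proof -
  obtain s where "time_reversal m \<epsilon> s" using eps_ok_time_reversal[OF assms(2)] by blast
  then interpret time_reversal m \<epsilon> s .
  show ?thesis
    using null_homotopic_imp_multistep_log multistep_log_imp_beta[OF assms(3)] beta_imp_null_homotopic by blast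
qed

end
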